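(* Let $A=A^T\in\mathbb{R}^{n\times n}$ with $A\prec 0$, $N_i=N_i^T\in\mathbb{R}^{n\times n}$ for $i=1,\dots,m$, $B\in\mathbb{R}^{n\times r}$ and $C=B^T$, and let $\Sigma$ be the bilinear system given by $(A,N_1,\dots,N_m,B,C)$. Assume $\rho(\mathscr{L}^{-1}\Pi)<1$. Let $X$ be the solution of $AX+XA+\sum_{i=1}^m N_iXN_i+BB^T=0$. Given $V\in\mathbb{R}^{n\times k}$, $k<n$, with $V^TV=I$, let $\hat\Sigma$ be the reduced bilinear system given by $\hat A=V^TAV$, $\hat N_i=V^TN_iV$ for $i=1,\dots,m$, and $\hat B=V^TB=\hat C^T$, and let $\hat X$ solve $\hat A\hat X+\hat X\hat A+\sum_{i=1}^m\hat N_i\hat X\hat N_i^T+\hat B\hat B^T=0$. If $\hat\Sigma$ is locally $\mathcal{H}_2$-optimal, then $V\hat XV^T$ is locally optimal with respect to the $\mathcal{M}$-norm; that is, $V$ is a local minimizer of $$W\mapsto\|X-W\hat X_WW^T\|_{\mathcal{M}}$$ over all $W\in\mathbb{R}^{n\times k}$ with $W^TW=I$, where $\hat X_W$ denotes the solution of the projected equation $$(W^TAW)\hat X_W+\hat X_W(W^TAW)+\sum_{i=1}^m(W^TN_iW)\hat X_W(W^TN_iW)+W^TBB^TW=0$$ (so that $\hat X_V=\hat X$).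
   Context: $\mathscr{L}(X):=AX+XA^T$, $\Pi(X):=\sum_{i=1}^m N_iXN_i^T$ on $\mathbb{R}^{n\times n}$; $\rho$ is the spectral radius. $\mathcal{M}(X):=-\mathscr{L}(X)-\Pi(X)$, $\langle X,Y\rangle_{\mathcal{M}}:=\mathrm{trace}(X^T\mathcal{M}(Y))$, $\|X\|_{\mathcal{M}}^2:=\langle X,X\rangle_{\mathcal{M}}$. A bilinear system $\Sigma$ given by $(A,N_1,\dots,N_m,B,C)$ is $\dot x(t)=Ax(t)+\sum_{i=1}^m N_ix(t)w_i(t)+Bu(t)$, $y(t)=Cx(t)$, with inputs $u(t)\in\mathbb{R}^r$, $w(t)\in\mathbb{R}^m$. Its $\mathcal{H}_2$-norm is $$\|\Sigma\|_{\mathcal{H}_2}^2:=\mathrm{trace}\Big(\sum_{j=1}^\infty\int_0^\infty\!\!\cdots\!\int_0^\infty\ \sum_{\ell_1,\dots,\ell_{j-1}=1}^m\ \sum_{\ell_j=1}^r g_j^{(\ell_1,\dots,\ell_j)}\big(g_j^{(\ell_1,\dots,\ell_j)}\big)^T\,ds_1\cdots ds_j\Big),$$ $$g_j^{(\ell_1,\dots,\ell_j)}(s_1,\dots,s_j):=Ce^{As_j}N_{\ell_1}e^{As_{j-1}}N_{\ell_2}\cdots e^{As_1}b_{\ell_j},$$ where $b_\ell$ is the $\ell$-th column of $B$ and $g_j$ contains $N_{\ell_1},\dots,N_{\ell_{j-1}}$. When the bilinear Gramians exist, $\|\Sigma\|_{\mathcal{H}_2}^2=\mathrm{trace}(CPC^T)$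 with $P$ the controllability Gramian, which satisfies $AP+PA^T+\sum_{i=1}^m N_iPN_i^T+BB^T=0$. The error system $\Sigma-\hat\Sigma$ is the bilinear system with state matrix $\mathrm{diag}(A,\hat A)$, bilinear coupling matrices $\mathrm{diag}(N_i,\hat N_i)$, input matrix $\begin{bmatrix}B\\ \hat B\end{bmatrix}$ and output matrix $\begin{bmatrix}C&-\hat C\end{bmatrix}$. $\hat\Sigma$ is locally $\mathcal{H}_2$-optimal if it is a local minimizer of $\tilde\Sigma\mapsto\|\Sigma-\tilde\Sigma\|_{\mathcal{H}_2}$ over bilinear systems $\tilde\Sigma=(\tilde A,\tilde N_1,\dots,\tilde N_m,\tilde B,\tilde C)$ of state dimension $k$ (with the same input and output dimensions) for which the norm is defined. *)

theory Defs
  imports "HOL-Analysis.Analysis"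
begin

definition mat_exp :: "real^'s^'s \<Rightarrow> real^'s^'s" where
  "mat_exp A = (\<Sum>q. (1 / fact q) *\<^sub>R (((**) A) ^^ q) (mat 1))"

definition lyap :: "real^'s^'s \<Rightarrow> real^'s^'s \<Rightarrow> real^'s^'s" where
  "lyap A X = A ** X + X ** transpose A"

definition coupling :: "real^'s^'s^'m \<Rightarrow> real^'s^'s \<Rightarrow> real^'s^'s" where
  "coupling N X = (\<Sum>i\<in>UNIV. N $ i ** X ** transpose (N $ i))"

definition M_op :: "real^'s^'s \<Rightarrow> real^'s^'s^'m \<Rightarrow> real^'s^'s \<Rightarrow> real^'s^'s" where
  "M_op A N X = - lyap A X - coupling N X"

definition M_inner ::
  "real^'s^'s \<Rightarrow> real^'s^'s^'m \<Rightarrow> real^'s^'s \<Rightarrow> real^'s^'s \<Rightarrow> real" where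
  "M_inner A N X Y = trace (transpose X ** M_op A N Y)"

definition M_norm :: "real^'s^'s \<Rightarrow> real^'s^'s^'m \<Rightarrow> real^'s^'s \<Rightarrow> real" where
  "M_norm A N X = sqrt (M_inner A N X X)"

(* Eigenvalues of the complexification of T: the condition below is the equation
   T (x + i y) = lam (x + i y), split into real and imaginary parts. *)
definition complex_eigenvalue :: "('v::real_vector \<Rightarrow> 'v) \<Rightarrow> complex \<Rightarrow> bool" where
  "complex_eigenvalue T lam \<longleftrightarrow>
     (\<exists>x y. (x \<noteq> 0 \<or> y \<noteq> 0) \<and>
        T x = Re lam *\<^sub>R x - Im lam *\<^sub>R y \<and>
        T y = Im lam *\<^sub>R x + Re lam *\<^sub>R y)"

definition spectral_radius :: "('v::real_vector \<Rightarrow> 'v) \<Rightarrow> real" where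
  "spectral_radius T = Sup (cmod ` {lam. complex_eigenvalue T lam})"

(* State dimension 's, coupling index 'm, inputs 'r, outputs 'p: a tuple (A, N, B, C).
   The topology on systems is that of this finite-dimensional product space. *)
type_synonym ('s, 'm, 'r, 'p) bilinear_system =
  "(real^'s^'s) \<times> (real^'s^'s^'m) \<times> (real^'r^'s) \<times> (real^'s^'p)"

(* For j = length ls + 1 this is
   exp(A s_j) N_(l_1) exp(A s_(j-1)) N_(l_2) ... N_(l_(j-1)) exp(A s_1) b,
   where ls = [l_1, ..., l_(j-1)]. *)
fun state_kernel ::
  "real^'s^'s \<Rightarrow> real^'s^'s^'m \<Rightarrow> real^'s \<Rightarrow> 'm list \<Rightarrow> (nat \<Rightarrow> real) \<Rightarrow> real^'s" where
  "state_kernel A N b [] s = mat_exp (s 1 *\<^sub>R A) *v b"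
| "state_kernel A N b (l # ls) s =
     mat_exp (s (length ls + 2) *\<^sub>R A) *v (N $ l *v state_kernel A N b ls s)"

definition outer_square :: "real^'p \<Rightarrow> real^'p^'p" where
  "outer_square g = (\<chi> a b. g $ a * g $ b)"

fun h2_integrand ::
  "('s::finite, 'm::finite, 'r::finite, 'p::finite) bilinear_system \<Rightarrow> nat \<Rightarrow> (nat \<Rightarrow> real) \<Rightarrow> real^'p^'p" where
  "h2_integrand (A, N, B, C) j s =
     (\<Sum>ls | length ls = j - 1. \<Sum>l\<in>UNIV.
        outer_square (C *v state_kernel A N (column l B) ls s))"

abbreviation time_measure :: "nat \<Rightarrow> (nat \<Rightarrow> real) measure" where
  "time_measure j \<equiv> Pi\<^sub>M {1..j} (\<lambda>_. lborel)"

abbreviation time_domain :: "nat \<Rightarrow> (nat \<Rightarrow> real) set" where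
  "time_domain j \<equiv> {1..j} \<rightarrow>\<^sub>E {0..}"

definition h2_term :: "('s::finite, 'm::finite, 'r::finite, 'p::finite) bilinear_system \<Rightarrow> nat \<Rightarrow> real^'p^'p" where
  "h2_term \<Sigma> j = set_lebesgue_integral (time_measure j) (time_domain j) (h2_integrand \<Sigma> j)"

(* The series over j = 1, 2, ... is indexed by j = Suc i.  The norm is defined when all the
   integrals and the series converge.  The integrands are positive semidefinite, so
   integrability on the product space is convergence of the iterated integrals. *)
definition h2_defined :: "('s::finite, 'm::finite, 'r::finite, 'p::finite) bilinear_system \<Rightarrow> bool" where
  "h2_defined \<Sigma> \<longleftrightarrow>
     (\<forall>j\<ge>1. set_integrable (time_measure j) (time_domain j) (h2_integrand \<Sigma> j)) \<and>
     summable (\<lambda>i. h2_term \<Sigma> (Suc i))"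

definition h2_norm :: "('s::finite, 'm::finite, 'r::finite, 'p::finite) bilinear_system \<Rightarrow> real" where
  "h2_norm \<Sigma> = sqrt (trace (\<Sum>i. h2_term \<Sigma> (Suc i)))"

definition block_diag :: "real^'n^'n \<Rightarrow> real^'k^'k \<Rightarrow> real^('n + 'k)^('n + 'k)" where
  "block_diag P Q = (\<chi> a b. case (a, b) of
       (Inl i, Inl j) \<Rightarrow> P $ i $ j
     | (Inr i, Inr j) \<Rightarrow> Q $ i $ j
     | _ \<Rightarrow> 0)"

definition stack_rows :: "real^'r^'n \<Rightarrow> real^'r^'k \<Rightarrow> real^'r^('n + 'k)" where
  "stack_rows P Q = (\<chi> a j. case a of Inl i \<Rightarrow> P $ i $ j | Inr i \<Rightarrow> Q $ i $ j)"

definition join_columns :: "real^'n^'p \<Rightarrow> real^'k^'p \<Rightarrow> real^('n + 'k)^'p" where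
  "join_columns P Q = (\<chi> i b. case b of Inl j \<Rightarrow> P $ i $ j | Inr j \<Rightarrow> Q $ i $ j)"

fun error_system ::
  "('n::finite, 'm::finite, 'r::finite, 'p::finite) bilinear_system \<Rightarrow> ('k::finite, 'm, 'r, 'p) bilinear_system
     \<Rightarrow> ('n + 'k, 'm, 'r, 'p) bilinear_system" where
  "error_system (A, N, B, C) (A', N', B', C') =
     (block_diag A A', \<chi> i. block_diag (N $ i) (N' $ i), stack_rows B B', join_columns C (- C'))"

definition local_minimizer ::
  "('a::topological_space \<Rightarrow> real) \<Rightarrow> 'a set \<Rightarrow> 'a \<Rightarrow> bool" where
  "local_minimizer f S x \<longleftrightarrow> x \<in> S \<and> (\<forall>\<^sub>F y in at x within S. f x \<le> f y)"

definition locally_h2_optimal ::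
  "('n::finite, 'm::finite, 'r::finite, 'p::finite) bilinear_system \<Rightarrow> ('k::finite, 'm, 'r, 'p) bilinear_system \<Rightarrow> bool" where
  "locally_h2_optimal \<Sigma> \<Sigma>' \<longleftrightarrow>
     local_minimizer (\<lambda>S. h2_norm (error_system \<Sigma> S)) {S. h2_defined (error_system \<Sigma> S)} \<Sigma>'"

definition projected_solution ::
  "real^'n^'n \<Rightarrow> real^'n^'n^'m \<Rightarrow> real^'r^'n \<Rightarrow> real^'k^'n \<Rightarrow> real^'k^'k" where
  "projected_solution A N B W = (THE Y.
     (transpose W ** A ** W) ** Y + Y ** (transpose W ** A ** W)
     + (\<Sum>i\<in>UNIV. (transpose W ** N $ i ** W) ** Y ** (transpose W ** N $ i ** W))
     + transpose W ** B ** transpose B ** W = 0)"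

end

theory Submission
  imports Defs
begin

text \<open>Write \<open>h W\<close> for the squared H2 error of the Galerkin system of \<open>W\<close> and \<open>f W\<close> for its squared
  \<open>M\<close>-norm error. In terms of the Gramian \<open>X\<close>, the projected Gramian and the mixed block \<open>Y\<close> of the
  error Gramian, \<open>f W = x - b\<close> and \<open>h W = x - 2 * a + b\<close>, where \<open>x\<close>, \<open>b\<close> and \<open>a\<close> are the \<open>M\<close>-energies
  of the full, the projected and the mixed solution. The projected solution is the Galerkin
  approximation of the mixed one, so \<open>b \<le> a\<close> and hence \<open>h \<le> f\<close>. Scaling only the output matrix of
  the optimal system by \<open>t\<close> gives the squared error \<open>x - 2 * t * a + t\<^sup>2 * b\<close>, which is stationary at
  \<open>t = 1\<close>; thus \<open>a = b\<close> and \<open>f V = h V \<le> h W \<le> f W\<close> for \<open>W\<close> near \<open>V\<close>.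

  The spectral radius condition says that the form of the coupling operator is dominated in absolute
  value by that of \<open>- lyap A\<close>. Unlike the spectral radius, this domination passes visibly to
  compressions and to the error system, and it makes the series of Gramian terms converge
  geometrically.\<close>

section \<open>Quadratic forms on Euclidean spaces\<close>

text \<open>The quotient of the two forms is homogeneous of degree 0, so its maximum over the
  compact unit sphere bounds it everywhere. The maximizer \<open>e\<close> is exported because later
  arguments need the bound to be attained.\<close>

lemma Rayleigh_quotient_max:
  fixes G H :: "'a::euclidean_space \<Rightarrow> 'a"
  assumes "linear G" "linear H" and pos: "\<And>x. x \<noteq> 0 \<Longrightarrow> 0 < x \<bullet> G x"
  obtains e where "norm e = 1" "\<And>x. x \<bullet> H x \<le> (e \<bullet> H e) / (e \<bullet> G e) * (x \<bullet> G x)"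
proof -
  let ?S = "sphere (0::'a) 1"
  let ?q = "\<lambda>x. (x \<bullet> H x) / (x \<bullet> G x)"
  have [continuous_intros]: "continuous_on ?S G" "continuous_on ?S H"
    using assms(1,2) by (auto intro!: linear_continuous_on simp: linear_conv_bounded_linear)
  have nz: "x \<bullet> G x \<noteq> 0" if "x \<in> ?S" for x
    using pos[of x] that by force
  have "continuous_on ?S ?q"
    by (intro continuous_intros) (use nz in auto)
  moreover have "?S \<noteq> {}"
    by (simp add: sphere_eq_empty)
  ultimately obtain e where e: "e \<in> ?S" "\<And>x. x \<in> ?S \<Longrightarrow> ?q x \<le> ?q e"
    using continuous_attains_sup[of ?S ?q] by auto
  show thesis
  proof
    show "norm e = 1" using e(1) by simp
    show "x \<bullet> H x \<le> ?q e * (x \<bullet> G x)" for x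
    proof (cases "x = 0")
      case False
      define u where "u = x /\<^sub>R norm x"
      have xu: "x = norm x *\<^sub>R u" and u: "u \<in> ?S" using False by (auto simp: u_def)
      have "u \<noteq> 0" using u by auto
      have "u \<bullet> H u \<le> ?q e * (u \<bullet> G u)"
        using e(2)[OF u] pos[OF \<open>u \<noteq> 0\<close>] by (simp add: divide_le_eq)
      then have "(norm x)\<^sup>2 * (u \<bullet> H u) \<le> (norm x)\<^sup>2 * (?q e * (u \<bullet> G u))"
        by (rule mult_left_mono) simp
      moreover have "x \<bullet> H x = (norm x)\<^sup>2 * (u \<bullet> H u)" "x \<bullet> G x = (norm x)\<^sup>2 * (u \<bullet> G u)"
        by (subst (1 2) xu, simp add: linear_cmul assms power2_eq_square del: inner_commute)+
      ultimately show ?thesis by (simp add: algebra_simps)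
    qed (simp add: linear_0 assms)
  qed
qed

lemma pos_form_coercive:
  fixes G :: "'a::euclidean_space \<Rightarrow> 'a"
  assumes "linear G" and pos: "\<And>x. x \<noteq> 0 \<Longrightarrow> 0 < x \<bullet> G x"
  obtains c where "0 < c" "\<And>x. c * (norm x)\<^sup>2 \<le> x \<bullet> G x"
proof -
  \<comment> \<open>With the identity as second form, the maximal quotient is
    \<open>1 / (e \<bullet> G e)\<close>, so the coercivity constant is
    \<open>e \<bullet> G e\<close>.\<close>
  obtain e where e: "norm e = 1" "\<And>x. x \<bullet> x \<le> (e \<bullet> e) / (e \<bullet> G e) * (x \<bullet> G x)"
    using Rayleigh_quotient_max[OF assms(1) linear_id pos] by auto
  have p: "0 < e \<bullet> G e" using e(1) by (intro pos) auto
  have "e \<bullet> e = 1" using e(1) by (simp add: dot_square_norm)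
  with e(2) have "(e \<bullet> G e) * (norm x)\<^sup>2 \<le> x \<bullet> G x" for x
    using p by (simp add: dot_square_norm field_simps)
  with p show thesis by (rule that)
qed

text \<open>Strict domination at every nonzero vector becomes uniform by compactness: the quotients
  of \<open>H\<close> and of \<open>- H\<close> attain their maxima, which are therefore below
  1.\<close>

lemma dominated_form_contraction:
  fixes G H :: "'a::euclidean_space \<Rightarrow> 'a"
  assumes lin: "linear G" "linear H" and dom: "\<And>x. x \<noteq> 0 \<Longrightarrow> \<bar>x \<bullet> H x\<bar> < x \<bullet> G x"
  obtains q where "0 \<le> q" "q < 1" "\<And>x. \<bar>x \<bullet> H x\<bar> \<le> q * (x \<bullet> G x)"
proof -
  have pos: "0 < x \<bullet> G x" if "x \<noteq> 0" for x using dom[OF that] by linarith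
  have pos0: "0 \<le> x \<bullet> G x" for x using pos[of x] by (cases "x = 0") auto
  obtain d where d: "norm d = 1" "\<And>x. x \<bullet> H x \<le> (d \<bullet> H d) / (d \<bullet> G d) * (x \<bullet> G x)"
    using Rayleigh_quotient_max[OF lin pos] by auto
  obtain e where e: "norm e = 1" "\<And>x. x \<bullet> - H x \<le> (e \<bullet> - H e) / (e \<bullet> G e) * (x \<bullet> G x)"
    using Rayleigh_quotient_max[OF lin(1) linear_compose_neg[OF lin(2)] pos] by auto
  let ?q = "max 0 (max ((d \<bullet> H d) / (d \<bullet> G d)) ((e \<bullet> - H e) / (e \<bullet> G e)))"
  have "d \<noteq> 0" "e \<noteq> 0" using d(1) e(1) by auto
  show thesis
  proof
    show "?q < 1"
      using dom[OF \<open>d \<noteq> 0\<close>] dom[OF \<open>e \<noteq> 0\<close>] pos[OF \<open>d \<noteq> 0\<close>] pos[OF \<open>e \<noteq> 0\<close>]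
      by (auto simp: divide_less_eq less_divide_eq abs_less_iff)
    show "\<bar>x \<bullet> H x\<bar> \<le> ?q * (x \<bullet> G x)" for x
    proof -
      have "x \<bullet> H x \<le> ?q * (x \<bullet> G x)" "x \<bullet> - H x \<le> ?q * (x \<bullet> G x)"
        by (rule order_trans[OF d(2)] order_trans[OF e(2)], rule mult_right_mono[OF _ pos0], simp)+
      then show ?thesis by simp
    qed
  qed simp
qed

lemma linear_coeff_zero_if_nonneg:
  fixes b c :: real
  assumes "\<And>t. 0 \<le> t * b + t\<^sup>2 * c"
  shows "b = 0"
proof (rule ccontr)
  assume "b \<noteq> 0"
  have *: "0 \<le> - b\<^sup>2 * s + s\<^sup>2 * b\<^sup>2 * c" for s
    using assms[of "- s * b"] by (simp add: power2_eq_square algebra_simps)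
  \<comment> \<open>The choice \<open>t = - s * b\<close> gives the value
    \<open>b\<^sup>2 * s * (s * c - 1)\<close>, which is negative once \<open>s\<close> is positive
    and \<open>s * c < 1\<close>.\<close>
  define s where "s = 1 / (\<bar>c\<bar> + 1)"
  have "0 < s" "s * c < 1" by (auto simp: s_def divide_less_eq)
  then have "b\<^sup>2 * s * (s * c - 1) < 0" using \<open>b \<noteq> 0\<close> by (intro mult_pos_neg) auto
  with *[of s] show False by (simp add: power2_eq_square algebra_simps)
qed

text \<open>The form attains its minimum 0 at \<open>x\<close>, so its first variation
  \<open>2 * (y \<bullet> Q x)\<close> vanishes in every direction \<open>y\<close>.\<close>

lemma selfadjoint_nonneg_kernel:
  fixes Q :: "'a::real_inner \<Rightarrow> 'a"
  assumes "linear Q" and sym: "\<And>x y. x \<bullet> Q y = y \<bullet> Q x"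
    and nonneg: "\<And>x. 0 \<le> x \<bullet> Q x" and zero: "x \<bullet> Q x = 0"
  shows "Q x = 0"
proof -
  have "0 \<le> t * (2 * (y \<bullet> Q x)) + t\<^sup>2 * (y \<bullet> Q y)" for y t
    using nonneg[of "x + t *\<^sub>R y"] sym[of x y] zero
    by (simp add: linear_add linear_cmul assms(1) inner_add_left inner_add_right power2_eq_square)
  then have "y \<bullet> Q x = 0" for y
    using linear_coeff_zero_if_nonneg[of "2 * (y \<bullet> Q x)" "y \<bullet> Q y"] by simp
  then show ?thesis by (metis inner_eq_zero_iff)
qed

text \<open>Let \<open>\<mu>\<close> be the maximal Rayleigh quotient, attained at \<open>e\<close>.
  Then \<open>\<mu> *\<^sub>R G x - H x\<close> defines a nonnegative selfadjoint form that vanishes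
  at \<open>e\<close>, so \<open>e\<close> lies in its kernel. The vector \<open>z\<close> forces
  the maximum to be at least 1.\<close>

lemma generalized_eigenvalue_ge_1:
  fixes G H :: "'a::euclidean_space \<Rightarrow> 'a"
  assumes lin: "linear G" "linear H"
    and G_sym: "\<And>x y. x \<bullet> G y = y \<bullet> G x" and H_sym: "\<And>x y. x \<bullet> H y = y \<bullet> H x"
    and pos: "\<And>x. x \<noteq> 0 \<Longrightarrow> 0 < x \<bullet> G x"
    and z: "z \<noteq> 0" "z \<bullet> G z \<le> z \<bullet> H z"
  obtains \<mu> e where "e \<noteq> 0" "1 \<le> \<mu>" "H e = \<mu> *\<^sub>R G e"
proof -
  obtain e where e: "norm e = 1" "\<And>x. x \<bullet> H x \<le> (e \<bullet> H e) / (e \<bullet> G e) * (x \<bullet> G x)"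
    using Rayleigh_quotient_max[OF lin pos] by auto
  define \<mu> where "\<mu> = (e \<bullet> H e) / (e \<bullet> G e)"
  have "e \<noteq> 0" using e(1) by auto
  have "z \<bullet> G z \<le> \<mu> * (z \<bullet> G z)" using e(2)[of z] z(2) by (simp add: \<mu>_def)
  then have "1 \<le> \<mu>" using pos[OF z(1)] by simp
  have "linear (\<lambda>x. \<mu> *\<^sub>R G x - H x)"
    by (intro linear_compose_sub linear_compose_scale_right lin)
  moreover have "e \<bullet> (\<mu> *\<^sub>R G e - H e) = 0"
    using pos[OF \<open>e \<noteq> 0\<close>] by (simp add: \<mu>_def inner_diff_right)
  ultimately have "\<mu> *\<^sub>R G e - H e = 0"
    by (intro selfadjoint_nonneg_kernel[where Q = "\<lambda>x. \<mu> *\<^sub>R G x - H x"])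
      (use G_sym H_sym e(2) in \<open>auto simp: inner_diff_right \<mu>_def\<close>)
  with \<open>e \<noteq> 0\<close> \<open>1 \<le> \<mu>\<close> show thesis by (intro that) auto
qed

lemma pos_form_injective:
  fixes G :: "'a::real_inner \<Rightarrow> 'a"
  assumes "linear G" "\<And>x. x \<noteq> 0 \<Longrightarrow> 0 < x \<bullet> G x"
  shows "inj G"
  using assms(2) by (force simp: linear_injective_0[OF assms(1)])

text \<open>A supremum of reals dominates its set only if the set is bounded above, so the moduli of
  all complex eigenvalues are first bounded by an operator norm bound of \<open>T\<close>.\<close>

lemma real_eigenvalue_le_spectral_radius:
  fixes T :: "'a::euclidean_space \<Rightarrow> 'a"
  assumes "linear T" "x \<noteq> 0" "T x = c *\<^sub>R x"
  shows "\<bar>c\<bar> \<le> spectral_radius T"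
proof -
  obtain K where K: "0 < K" "\<And>x. norm (T x) \<le> norm x * K"
    using bounded_linear.pos_bounded linear_conv_bounded_linear assms(1) by blast
  have "cmod lam \<le> K" if lam: "complex_eigenvalue T lam" for lam
  proof -
    obtain x y where xy: "x \<noteq> 0 \<or> y \<noteq> 0" "T x = Re lam *\<^sub>R x - Im lam *\<^sub>R y"
      "T y = Im lam *\<^sub>R x + Re lam *\<^sub>R y"
      using lam unfolding complex_eigenvalue_def by blast
    let ?s = "(norm x)\<^sup>2 + (norm y)\<^sup>2"
    \<comment> \<open>On the pair of real and imaginary parts, \<open>T\<close> acts as
      multiplication by \<open>lam\<close>, which scales the sum of the squared norms by the squared
      modulus; the cross terms cancel.\<close>
    have "(cmod lam)\<^sup>2 * ?s = (norm (T x))\<^sup>2 + (norm (T y))\<^sup>2"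
      unfolding xy(2,3) cmod_power2 power2_norm_eq_inner
      by (simp add: inner_diff inner_add power2_eq_square inner_commute[of y x]) algebra
    also have "\<dots> \<le> (norm x * K)\<^sup>2 + (norm y * K)\<^sup>2"
      by (intro add_mono power_mono K) auto
    finally have "(cmod lam)\<^sup>2 * ?s \<le> K\<^sup>2 * ?s" by (simp add: power_mult_distrib algebra_simps)
    moreover have "0 < ?s" using xy(1) by (auto simp: add_pos_nonneg add_nonneg_pos)
    ultimately have "(cmod lam)\<^sup>2 \<le> K\<^sup>2" by simp
    then show ?thesis using K(1) by (simp add: power2_le_iff_abs_le)
  qed
  then have "bdd_above (cmod ` {lam. complex_eigenvalue T lam})"
    by (auto intro!: bdd_aboveI[where M = K])
  moreover have "complex_eigenvalue T (of_real c)"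
    unfolding complex_eigenvalue_def
    by (rule exI[of _ x], rule exI[of _ 0]) (use assms in \<open>simp add: linear_0\<close>)
  ultimately have "cmod (of_real c) \<le> spectral_radius T"
    unfolding spectral_radius_def by (intro cSup_upper imageI) auto
  then show ?thesis by simp
qed

text \<open>If the form of \<open>H\<close> or of \<open>- H\<close> reached that of
  \<open>G\<close> at \<open>x\<close>, there would be \<open>e \<noteq> 0\<close> with
  \<open>H e = \<mu> *\<^sub>R G e\<close> and modulus of \<open>\<mu>\<close> at least 1. Then
  \<open>- \<mu>\<close> is an eigenvalue of the composite operator, against the bound on its
  spectral radius.\<close>

lemma form_dominated_if_spectral_radius_less_1:
  fixes G H :: "'a::euclidean_space \<Rightarrow> 'a"
  assumes lin: "linear G" "linear H"
    and G_sym: "\<And>x y. x \<bullet> G y = y \<bullet> G x" and H_sym: "\<And>x y. x \<bullet> H y = y \<bullet> H x"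
    and pos: "\<And>x. x \<noteq> 0 \<Longrightarrow> 0 < x \<bullet> G x"
    and rho: "spectral_radius (inv (\<lambda>x. - G x) \<circ> H) < 1"
    and "x \<noteq> 0"
  shows "\<bar>x \<bullet> H x\<bar> < x \<bullet> G x"
proof -
  let ?L = "\<lambda>x. - G x"
  have linL: "linear ?L" using lin(1) by (rule linear_compose_neg)
  have injL: "inj ?L"
    using pos_form_injective[OF lin(1) pos] by (simp add: inj_def)
  have linT: "linear (inv ?L \<circ> H)"
    by (intro linear_compose lin inj_linear_imp_inv_linear linL injL)
  have no_eigenvector: False if "e \<noteq> 0" "1 \<le> \<bar>\<mu>\<bar>" "H e = \<mu> *\<^sub>R G e" for e \<mu>
  proof -
    have "H e = ?L ((- \<mu>) *\<^sub>R e)" using that(3) by (simp add: linear_neg linear_cmul lin)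
    then have "(inv ?L \<circ> H) e = (- \<mu>) *\<^sub>R e" using inv_f_f[OF injL, of "(- \<mu>) *\<^sub>R e"] by simp
    then show False
      using real_eigenvalue_le_spectral_radius[OF linT that(1), of "- \<mu>"] that(2) rho by simp
  qed
  have "x \<bullet> H x < x \<bullet> G x"
  proof (rule ccontr)
    assume "\<not> ?thesis"
    then have "x \<bullet> G x \<le> x \<bullet> H x" by simp
    then obtain \<mu> e where "e \<noteq> 0" "1 \<le> \<mu>" "H e = \<mu> *\<^sub>R G e"
      using generalized_eigenvalue_ge_1[OF lin G_sym H_sym pos \<open>x \<noteq> 0\<close>] by metis
    then show False using no_eigenvector[of e \<mu>] by simp
  qed
  moreover have "- (x \<bullet> H x) < x \<bullet> G x"
  proof (rule ccontr)
    assume "\<not> ?thesis"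
    then have "x \<bullet> G x \<le> x \<bullet> - H x" by simp
    moreover have "y \<bullet> - H z = z \<bullet> - H y" for y z by (simp add: H_sym[of y])
    moreover have lin': "linear (\<lambda>x. - H x)" using lin(2) by (rule linear_compose_neg)
    ultimately obtain \<mu> e where "e \<noteq> 0" "1 \<le> \<mu>" "- H e = \<mu> *\<^sub>R G e"
      using generalized_eigenvalue_ge_1[OF lin(1) lin' G_sym _ pos \<open>x \<noteq> 0\<close>] by metis
    then show False using no_eigenvector[of e "- \<mu>"] by (simp add: minus_equation_iff[of "H e"])
  qed
  ultimately show ?thesis by linarith
qed

text \<open>The energies \<open>K i \<bullet> G (K i)\<close> decay geometrically; polarization replaces the
  Cauchy-Schwarz inequality for the form of \<open>G\<close>.\<close>

lemma dominated_iteration_sums: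
  fixes G H :: "'a::euclidean_space \<Rightarrow> 'a"
  assumes lin: "linear G" "linear H" and H_sym: "\<And>x y. x \<bullet> H y = y \<bullet> H x"
    and dom: "\<And>x. x \<noteq> 0 \<Longrightarrow> \<bar>x \<bullet> H x\<bar> < x \<bullet> G x"
    and start: "G (K 0) = Q" and step: "\<And>i. G (K (Suc i)) = H (K i)"
    and P: "G P - H P = Q"
  shows "K sums P"
proof -
  obtain q where q: "0 \<le> q" "q < 1" "\<And>x. \<bar>x \<bullet> H x\<bar> \<le> q * (x \<bullet> G x)"
    using dominated_form_contraction[OF lin dom] by blast
  have pos: "0 < x \<bullet> G x" if "x \<noteq> 0" for x using dom[OF that] by linarith
  obtain c where c: "0 < c" "\<And>x. c * (norm x)\<^sup>2 \<le> x \<bullet> G x"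
    using pos_form_coercive[OF lin(1) pos] by blast
  define a where "a x = x \<bullet> G x" for x
  \<comment> \<open>This factor results from solving the polarized estimate
    \<open>a (K (Suc i)) \<le> q / 2 * (a (K (Suc i)) + a (K i))\<close> for its left-hand
    side.\<close>
  define r where "r = q / (2 - q)"
  have r: "0 \<le> r" "r < 1" using q by (auto simp: r_def)
  have polar: "x \<bullet> H y \<le> q / 2 * (a x + a y)" for x y
  proof -
    have "4 * (x \<bullet> H y) = (x + y) \<bullet> H (x + y) - (x - y) \<bullet> H (x - y)"
      using H_sym[of x y]
      by (simp add: linear_add linear_diff lin inner_add inner_diff)
    also have "\<dots> \<le> q * a (x + y) + q * a (x - y)"
      using q(3)[of "x + y"] q(3)[of "x - y"] by (simp add: a_def)
    also have "\<dots> = q * (2 * (a x + a y))"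
      by (simp add: a_def linear_add linear_diff lin inner_add inner_diff algebra_simps)
    finally have "4 * (x \<bullet> H y) \<le> 4 * (q / 2 * (a x + a y))" by (simp add: algebra_simps)
    then show ?thesis by (rule mult_left_le_imp_le) simp
  qed
  have a_step: "a (K (Suc i)) \<le> r * a (K i)" for i
  proof -
    have "a (K (Suc i)) \<le> q / 2 * (a (K (Suc i)) + a (K i))"
      using polar[of "K (Suc i)" "K i"] by (simp add: a_def step)
    then have "(2 - q) * a (K (Suc i)) \<le> q * a (K i)" by (simp add: algebra_simps)
    then show ?thesis using q by (simp add: r_def field_simps)
  qed
  have a_bound: "a (K i) \<le> r ^ i * a (K 0)" for i
  proof (induction i)
    case (Suc i)
    have "a (K (Suc i)) \<le> r * (r ^ i * a (K 0))"
      by (rule order_trans[OF a_step mult_left_mono[OF Suc r(1)]])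
    then show ?case by simp
  qed simp
  have norm_bound: "norm (K i) \<le> sqrt (a (K 0) / c) * sqrt r ^ i" for i
  proof -
    have "(norm (K i))\<^sup>2 \<le> a (K 0) / c * r ^ i"
      using order_trans[OF c(2)[of "K i"] a_bound[of i, unfolded a_def[of "K i"]]] c(1)
      by (simp add: field_simps)
    then have "norm (K i) \<le> sqrt (a (K 0) / c * r ^ i)" by (rule real_le_rsqrt)
    then show ?thesis by (simp add: real_sqrt_mult real_sqrt_divide real_sqrt_power)
  qed
  have "summable (\<lambda>i. sqrt (a (K 0) / c) * sqrt r ^ i)"
    using r by (intro summable_mult summable_geometric) simp
  then have K: "summable K"
    by (rule summable_comparison_test') (use norm_bound in auto)
  have bl: "bounded_linear G" "bounded_linear H"
    using lin by (simp_all add: linear_conv_bounded_linear)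
  let ?S = "suminf K"
  have "G ?S = (\<Sum>i. G (K i))" by (rule bounded_linear.suminf[OF bl(1) K])
  also have "\<dots> = G (K 0) + (\<Sum>i. G (K (Suc i)))"
    using suminf_split_head[OF bounded_linear.summable[OF bl(1) K]] by simp
  also have "(\<Sum>i. G (K (Suc i))) = H ?S"
    by (simp add: step bounded_linear.suminf[OF bl(2) K])
  finally have S: "G ?S - H ?S = Q" by (simp add: start)
  \<comment> \<open>Both \<open>?S\<close> and \<open>P\<close> solve the same equation, and
    \<open>G - H\<close> has a positive definite form.\<close>
  have "?S = P"
  proof (rule ccontr)
    assume "?S \<noteq> P"
    then have "\<bar>(?S - P) \<bullet> H (?S - P)\<bar> < (?S - P) \<bullet> G (?S - P)" by (intro dom) simp
    moreover have "G (?S - P) = H (?S - P)" using S P by (simp add: linear_diff lin algebra_simps)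
    ultimately show False by simp
  qed
  with K show ?thesis by (simp add: sums_iff)
qed

section \<open>Matrix algebra with the trace inner product\<close>

lemma bounded_bilinear_matrix_mult:
  "bounded_bilinear ((**) :: real^'n^'m \<Rightarrow> real^'p^'n \<Rightarrow> real^'p^'m)"
  unfolding bilinear_conv_bounded_bilinear[symmetric] bilinear_def
  by (auto intro!: linearI simp: matrix_matrix_mult_def vec_eq_iff sum.distrib scaleR_right.sum
      sum_distrib_left algebra_simps)

interpretation matrix_mult:
  bounded_bilinear "(**) :: real^'n^'m \<Rightarrow> real^'p^'n \<Rightarrow> real^'p^'m"
  by (rule bounded_bilinear_matrix_mult)

lemma bounded_linear_transpose: "bounded_linear (transpose :: real^'n^'m \<Rightarrow> real^'m^'n)"
  unfolding linear_conv_bounded_linear[symmetric]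
  by (auto intro!: linearI simp: transpose_def vec_eq_iff)

lemmas linear_transpose = bounded_linear.linear[OF bounded_linear_transpose]
lemmas transpose_sum = linear_sum[OF linear_transpose]
lemmas transpose_add = linear_add[OF linear_transpose]
lemmas transpose_diff = linear_diff[OF linear_transpose]
lemmas transpose_zero = linear_0[OF linear_transpose]

text \<open>Identifies the Euclidean inner product of matrices with the trace product, so that the
  results on quadratic forms apply to operators on matrix spaces.\<close>

lemma inner_matrix_eq_trace: "X \<bullet> Y = trace (transpose X ** Y)" for X Y :: "real^'n^'m"
  unfolding inner_vec_def trace_def matrix_matrix_mult_def transpose_def
  by (simp add: sum.swap[of _ "UNIV :: 'n set"])

lemma inner_matrix_mult_left: "(P ** X) \<bullet> Y = X \<bullet> (transpose P ** Y)"
  for P :: "real^'n^'m" and X :: "real^'p^'n"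
  by (simp add: inner_matrix_eq_trace matrix_transpose_mul matrix_mul_assoc)

lemma inner_matrix_mult_right: "(X ** P) \<bullet> Y = X \<bullet> (Y ** transpose P)"
  for X :: "real^'n^'m" and P :: "real^'p^'n"
  by (simp add: inner_matrix_eq_trace matrix_transpose_mul matrix_mul_assoc[symmetric]
      trace_mul_sym[of "transpose P"])

lemma inner_transpose: "transpose X \<bullet> transpose Y = X \<bullet> Y" for X Y :: "real^'n^'m"
  using inner_matrix_eq_trace[of "transpose X" "transpose Y"]
  by (simp add: trace_mul_sym[of X] flip: inner_matrix_eq_trace inner_commute[of X])

lemma inner_matrix_vector_columns:
  "X \<bullet> (A ** X) = (\<Sum>j\<in>UNIV. column j X \<bullet> (A *v column j X))" for X :: "real^'n^'m"
  unfolding inner_vec_def matrix_matrix_mult_def matrix_vector_mult_def column_def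
  by (simp add: sum.swap[of _ "UNIV :: 'n set"])

section \<open>The Lyapunov and coupling operators\<close>

lemma linear_lyap: "linear (lyap A)"
  unfolding lyap_def
  by (intro linear_compose_add bounded_linear.linear matrix_mult.bounded_linear_left
      matrix_mult.bounded_linear_right)

lemma linear_coupling: "linear (coupling N)"
  unfolding coupling_def
  by (intro linear_compose_sum ballI bounded_linear.linear
      bounded_linear_compose[OF matrix_mult.bounded_linear_left matrix_mult.bounded_linear_right])

lemma lyap_selfadjoint:
  assumes "transpose A = A"
  shows "X \<bullet> lyap A Y = Y \<bullet> lyap A X"
  using inner_matrix_mult_left[of A Y X] inner_matrix_mult_right[of Y A X]
  by (simp add: lyap_def assms inner_add_right inner_commute)

lemma coupling_selfadjoint:
  assumes "\<And>i. transpose (N $ i) = N $ i"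
  shows "X \<bullet> coupling N Y = Y \<bullet> coupling N X"
proof -
  have "X \<bullet> (N $ i ** Y ** N $ i) = Y \<bullet> (N $ i ** X ** N $ i)" for i
    using inner_matrix_mult_left[of "N $ i" "Y ** N $ i" X]
      inner_matrix_mult_right[of Y "N $ i" "N $ i ** X"]
    by (simp add: assms matrix_mul_assoc inner_commute)
  then show ?thesis by (simp add: coupling_def assms inner_sum_right)
qed

text \<open>Left multiplication by \<open>A\<close> acts columnwise, so one nonzero column makes its
  form strictly negative. The other summand of \<open>lyap\<close> is the same form at the transpose
  of \<open>X\<close>.\<close>

lemma lyap_neg_definite:
  fixes X :: "real^'n^'n"
  assumes neg: "\<And>x. x \<noteq> 0 \<Longrightarrow> x \<bullet> (A *v x) < 0" and "X \<noteq> 0"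
  shows "0 < X \<bullet> - lyap A X"
proof -
  have *: "Y \<bullet> (A ** Y) < 0" if Y: "Y \<noteq> 0" for Y :: "real^'n^'n"
  proof -
    obtain j where j: "column j Y \<noteq> 0"
      using Y by (force simp: column_def vec_eq_iff)
    have nonpos: "x \<bullet> (A *v x) \<le> 0" for x using neg[of x] by (cases "x = 0") auto
    have "(\<Sum>j\<in>UNIV. column j Y \<bullet> (A *v column j Y)) < (\<Sum>j\<in>(UNIV :: 'n set). 0)"
      by (rule sum_strict_mono_ex1) (use nonpos neg[OF j] in auto)
    then show ?thesis by (simp add: inner_matrix_vector_columns)
  qed
  have "transpose X \<noteq> 0" using \<open>X \<noteq> 0\<close> by (metis transpose_transpose transpose_zero)
  moreover have "X \<bullet> (X ** transpose A) = transpose X \<bullet> (A ** transpose X)"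
    using inner_transpose[of X "X ** transpose A"] by (simp add: matrix_transpose_mul)
  ultimately show ?thesis
    using *[OF \<open>X \<noteq> 0\<close>] *[of "transpose X"] by (simp add: lyap_def inner_add_right inner_diff_right)
qed

text \<open>The absolute value makes this include positive definiteness of the forms of
  \<open>- lyap A\<close> and of \<open>M_op A N\<close>, so stability of \<open>A\<close> is not
  carried separately.\<close>

definition coupling_dominated :: "real^'s^'s \<Rightarrow> real^'s^'s^'m \<Rightarrow> bool" where
  "coupling_dominated A N \<longleftrightarrow> (\<forall>X. X \<noteq> 0 \<longrightarrow> \<bar>X \<bullet> coupling N X\<bar> < X \<bullet> - lyap A X)"

lemma coupling_dominated_if_spectral_radius:
  fixes A :: "real^'s^'s" and N :: "real^'s^'s^'m"
  assumes "transpose A = A" "\<And>i. transpose (N $ i) = N $ i"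
    and "\<And>x. x \<noteq> 0 \<Longrightarrow> x \<bullet> (A *v x) < 0"
    and "spectral_radius (inv (lyap A) \<circ> coupling N) < 1"
  shows "coupling_dominated A N"
  unfolding coupling_dominated_def
proof (intro allI impI)
  fix X :: "real^'s^'s" assume "X \<noteq> 0"
  show "\<bar>X \<bullet> coupling N X\<bar> < X \<bullet> - lyap A X"
  proof (rule form_dominated_if_spectral_radius_less_1[OF linear_compose_neg[OF linear_lyap]
        linear_coupling _ coupling_selfadjoint[OF assms(2)] lyap_neg_definite[OF assms(3)] _ \<open>X \<noteq> 0\<close>])
    show "Y \<bullet> - lyap A Z = Z \<bullet> - lyap A Y" for Y Z
      by (simp add: lyap_selfadjoint[OF assms(1), of Y])
      show "spectral_radius (inv (\<lambda>X. - (- lyap A X)) \<circ> coupling N) < 1"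
      using assms(4) by simp
  qed (use assms(3) in simp_all)
qed

lemma linear_M_op: "linear (M_op A N)"
  unfolding M_op_def by (intro linear_compose_sub linear_compose_neg linear_lyap linear_coupling)

lemma M_op_pos:
  assumes "coupling_dominated A N" "X \<noteq> 0"
  shows "0 < X \<bullet> M_op A N X"
  using assms(1)[unfolded coupling_dominated_def, rule_format, OF assms(2)]
  by (simp add: M_op_def inner_diff_right)

lemma M_op_nonneg:
  assumes "coupling_dominated A N"
  shows "0 \<le> X \<bullet> M_op A N X"
  using M_op_pos[OF assms, of X] by (cases "X = 0") auto

lemma M_op_selfadjoint:
  assumes "transpose A = A" "\<And>i. transpose (N $ i) = N $ i"
  shows "X \<bullet> M_op A N Y = Y \<bullet> M_op A N X"
  using lyap_selfadjoint[OF assms(1), of X Y] coupling_selfadjoint[OF assms(2), of X Y]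
  by (simp add: M_op_def inner_diff_right)

text \<open>A positive definite form makes the operator injective, hence bijective in finite
  dimension.\<close>

lemma M_op_unique_solution:
  assumes "coupling_dominated A N"
  shows "\<exists>!X. M_op A N X = Q"
proof -
  have "inj (M_op A N)" by (rule pos_form_injective[OF linear_M_op M_op_pos[OF assms]])
  with linear_injective_imp_surjective[OF linear_M_op] have "bij (M_op A N)" by (simp add: bij_def)
  then show ?thesis by (simp add: bij_iff)
qed

section \<open>Compressions\<close>

text \<open>The family \<open>F\<close> is a partition of an isometry into blocks: a single block gives a Galerkin
  projection, two blocks give a block diagonal system whose blocks are both projections.\<close>

locale compression =
  fixes F :: "'a::finite \<Rightarrow> real^'s^'n"
  assumes isometry: "(\<Sum>a\<in>UNIV. transpose (F a) ** F a) = mat 1"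
begin

definition compress :: "real^'n^'n \<Rightarrow> real^'s^'s" where
  "compress A = (\<Sum>a\<in>UNIV. transpose (F a) ** A ** F a)"

definition block :: "real^'s^'s \<Rightarrow> 'a \<Rightarrow> 'a \<Rightarrow> real^'n^'n" where
  "block Z a b = F a ** Z ** transpose (F b)"

text \<open>Insert the isometry identity between the two factors.\<close>

lemma inner_split_left: "X \<bullet> Y = (\<Sum>a\<in>UNIV. (F a ** X) \<bullet> (F a ** Y))"
proof -
  have "X \<bullet> Y = X \<bullet> ((\<Sum>a\<in>UNIV. transpose (F a) ** F a) ** Y)" by (simp add: isometry)
  then show ?thesis
    by (simp add: matrix_mult.sum_left inner_sum_right inner_matrix_mult_left matrix_mul_assoc)
qed

lemma inner_split_right: "X \<bullet> Y = (\<Sum>b\<in>UNIV. (X ** transpose (F b)) \<bullet> (Y ** transpose (F b)))"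
proof -
  have "X \<bullet> Y = X \<bullet> (Y ** (\<Sum>a\<in>UNIV. transpose (F a) ** F a))" by (simp add: isometry)
  then show ?thesis
    by (simp add: matrix_mult.sum_right inner_sum_right inner_matrix_mult_right matrix_mul_assoc)
qed

lemma transpose_compress: "transpose (compress A) = compress (transpose A)"
  by (simp add: compress_def transpose_sum matrix_transpose_mul matrix_mul_assoc)

text \<open>Moving each \<open>transpose (F a)\<close> to the other side leaves the form of
  \<open>A\<close> at \<open>F a ** Z\<close>, which is then split into blocks from the
  right.\<close>

lemma inner_compress_left: "Z \<bullet> (compress A ** Z) = (\<Sum>a\<in>UNIV. \<Sum>b\<in>UNIV. block Z a b \<bullet> (A ** block Z a b))"
proof -
  have "Z \<bullet> (compress A ** Z) = (\<Sum>a\<in>UNIV. (F a ** Z) \<bullet> (A ** F a ** Z))"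
    by (simp add: compress_def matrix_mult.sum_left inner_sum_right inner_matrix_mult_left matrix_mul_assoc)
  also have "\<dots> = (\<Sum>a\<in>UNIV. \<Sum>b\<in>UNIV. block Z a b \<bullet> (A ** block Z a b))"
    by (subst inner_split_right) (simp add: block_def matrix_mul_assoc)
  finally show ?thesis .
qed

lemma inner_compress_right:
  "Z \<bullet> (Z ** compress A) = (\<Sum>a\<in>UNIV. \<Sum>b\<in>UNIV. block Z a b \<bullet> (block Z a b ** A))"
proof -
  have "Z \<bullet> (Z ** compress A) = (\<Sum>b\<in>UNIV. (Z ** transpose (F b)) \<bullet> (Z ** transpose (F b) ** A))"
    by (simp add: compress_def matrix_mult.sum_right inner_sum_right inner_matrix_mult_right matrix_mul_assoc)
  also have "\<dots> = (\<Sum>b\<in>UNIV. \<Sum>a\<in>UNIV. block Z a b \<bullet> (block Z a b ** A))"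
    by (subst inner_split_left) (simp add: block_def matrix_mul_assoc)
  also have "\<dots> = (\<Sum>a\<in>UNIV. \<Sum>b\<in>UNIV. block Z a b \<bullet> (block Z a b ** A))" by (rule sum.swap)
  finally show ?thesis .
qed

lemma inner_compress_both:
  "Z \<bullet> (compress A ** Z ** compress B) = (\<Sum>a\<in>UNIV. \<Sum>b\<in>UNIV. block Z a b \<bullet> (A ** block Z a b ** B))"
proof -
  have "Z \<bullet> (transpose (F a) ** A ** F a ** Z ** transpose (F b) ** B ** F b)
      = block Z a b \<bullet> (A ** block Z a b ** B)" for a b
    using inner_matrix_mult_left[of "F a" "Z ** transpose (F b)" "A ** block Z a b ** B"]
      inner_matrix_mult_right[of Z "transpose (F b)" "transpose (F a) ** A ** block Z a b ** B"]
    by (simp add: block_def matrix_mul_assoc)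
  then show ?thesis
    by (simp add: compress_def matrix_mult.sum_left matrix_mult.sum_right inner_sum_right
        matrix_mul_assoc) (rule sum.swap)
qed

lemma inner_lyap_compress:
  "Z \<bullet> lyap (compress A) Z = (\<Sum>a\<in>UNIV. \<Sum>b\<in>UNIV. block Z a b \<bullet> lyap A (block Z a b))"
  by (simp add: lyap_def transpose_compress inner_compress_left inner_compress_right
      inner_add_right sum.distrib)

lemma inner_coupling_compress:
  assumes N': "\<And>i. N' $ i = compress (N $ i)"
  shows "Z \<bullet> coupling N' Z = (\<Sum>a\<in>UNIV. \<Sum>b\<in>UNIV. block Z a b \<bullet> coupling N (block Z a b))"
proof -
  have "Z \<bullet> coupling N' Z
      = (\<Sum>i\<in>UNIV. \<Sum>a\<in>UNIV. \<Sum>b\<in>UNIV. block Z a b \<bullet> (N $ i ** block Z a b ** transpose (N $ i)))"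
    by (simp add: coupling_def N' transpose_compress inner_compress_both inner_sum_right)
  also have "\<dots> = (\<Sum>a\<in>UNIV. \<Sum>b\<in>UNIV. block Z a b \<bullet> coupling N (block Z a b))"
    unfolding coupling_def inner_sum_right
    by (subst sum.swap, intro sum.cong refl, rule sum.swap)
  finally show ?thesis .
qed

text \<open>Both compressed forms at \<open>Z\<close> are sums of the original forms over the blocks
  of \<open>Z\<close>, so domination is inherited blockwise. It stays strict because the squared
  norm of \<open>Z\<close> is the sum of those of its blocks, whence some block is nonzero.\<close>

lemma coupling_dominated_compress:
  assumes dom: "coupling_dominated A N" and N': "\<And>i. N' $ i = compress (N $ i)"
  shows "coupling_dominated (compress A) N'"
  unfolding coupling_dominated_def
proof (intro allI impI)
  fix Z :: "real^'s^'s" assume "Z \<noteq> 0"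
  have dom': "\<bar>X \<bullet> coupling N X\<bar> < X \<bullet> - lyap A X" if "X \<noteq> 0" for X
    using dom that by (auto simp: coupling_dominated_def)
  have le: "\<bar>X \<bullet> coupling N X\<bar> \<le> X \<bullet> - lyap A X" for X
    using dom'[of X] by (cases "X = 0") auto
  have "Z \<bullet> Z = (\<Sum>a\<in>UNIV. \<Sum>b\<in>UNIV. block Z a b \<bullet> block Z a b)"
    by (subst inner_split_left, subst inner_split_right) (simp add: block_def)
  then obtain a b where "block Z a b \<noteq> 0"
    using \<open>Z \<noteq> 0\<close> by (metis (no_types, lifting) inner_eq_zero_iff sum.neutral inner_zero_left)
  then have ab: "block Z (fst (a, b)) (snd (a, b)) \<noteq> 0" by simp
  have "\<bar>Z \<bullet> coupling N' Z\<bar> \<le> (\<Sum>c\<in>UNIV. \<bar>block Z (fst c) (snd c) \<bullet> coupling N (block Z (fst c) (snd c))\<bar>)"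
    unfolding inner_coupling_compress[OF N'] sum.cartesian_product
    by (simp add: case_prod_beta sum_abs)
  also have "\<dots> < (\<Sum>c\<in>UNIV. block Z (fst c) (snd c) \<bullet> - lyap A (block Z (fst c) (snd c)))"
    by (rule sum_strict_mono_ex1) (use le dom'[OF ab] in \<open>auto intro!: bexI[of _ "(a, b)"]\<close>)
  also have "\<dots> = Z \<bullet> - lyap (compress A) Z"
    unfolding inner_minus_right inner_lyap_compress sum.cartesian_product
    by (simp add: case_prod_beta sum_negf)
  finally show "\<bar>Z \<bullet> coupling N' Z\<bar> < Z \<bullet> - lyap (compress A) Z" .
qed

end

section \<open>The Lyapunov flow\<close>

text \<open>Entrywise, the exponential is a scalar power series in \<open>t\<close>, which gives
  access to termwise differentiation. Convergence follows by comparison with the exponential series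
  of \<open>K * \<bar>t\<bar>\<close>.\<close>

lemma mat_exp_scaled_entry_sums:
  fixes A :: "real^'s^'s"
  shows "(\<lambda>q. (((**) A ^^ q) (mat 1)) $ i $ j / fact q * t ^ q) sums (mat_exp (t *\<^sub>R A) $ i $ j)"
proof -
  define P where "P q = ((**) A ^^ q) (mat 1)" for q
  have pow: "((**) (t *\<^sub>R A) ^^ q) (mat 1) = t ^ q *\<^sub>R P q" for q
    by (induction q) (simp_all add: P_def matrix_mult.scaleR_left matrix_mult.scaleR_right)
  obtain K where K: "0 < K" "\<And>X::real^'s^'s. norm (A ** X) \<le> norm X * K"
    using bounded_linear.pos_bounded[OF matrix_mult.bounded_linear_right] by blast
  have P_bound: "norm (P q) \<le> K ^ q * norm (mat 1 :: real^'s^'s)" for q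
  proof (induction q)
    case (Suc q)
    have "norm (P (Suc q)) \<le> norm (P q) * K" using K(2)[of "P q"] by (simp add: P_def)
    also have "\<dots> \<le> K ^ q * norm (mat 1 :: real^'s^'s) * K"
      using Suc K(1) by (intro mult_right_mono) auto
    finally show ?case by (simp add: mult.commute mult.left_commute)
  qed (simp add: P_def)
  have "summable (\<lambda>q. (1 / fact q) *\<^sub>R (t ^ q *\<^sub>R P q))"
  proof (rule summable_comparison_test')
    show "summable (\<lambda>q. (K * \<bar>t\<bar>) ^ q /\<^sub>R fact q * norm (mat 1 :: real^'s^'s))"
      by (intro summable_mult2 summable_exp_generic)
    show "norm ((1 / fact q) *\<^sub>R (t ^ q *\<^sub>R P q)) \<le> (K * \<bar>t\<bar>) ^ q /\<^sub>R fact q * norm (mat 1 :: real^'s^'s)" for q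
      using mult_left_mono[OF P_bound[of q], of "\<bar>t\<bar> ^ q / fact q"]
      by (simp add: power_abs power_mult_distrib field_simps)
  qed
  then have "(\<lambda>q. (1 / fact q) *\<^sub>R (t ^ q *\<^sub>R P q)) sums mat_exp (t *\<^sub>R A)"
    unfolding mat_exp_def pow by (rule summable_sums)
  then have "(\<lambda>q. ((1 / fact q) *\<^sub>R (t ^ q *\<^sub>R P q)) $ i $ j) sums (mat_exp (t *\<^sub>R A) $ i $ j)"
    by (intro bounded_linear.sums[OF bounded_linear_vec_nth]
        bounded_linear.sums[OF bounded_linear_vec_nth[of j]])
  then show ?thesis by (simp add: P_def field_simps)
qed

lemma has_vector_derivative_matrixI:
  fixes f :: "real \<Rightarrow> real^'n^'m"
  assumes "\<And>i j. ((\<lambda>t. f t $ i $ j) has_real_derivative f' $ i $ j) (at t)"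
  shows "(f has_vector_derivative f') (at t)"
proof -
  have "((\<lambda>x. f x \<bullet> b) has_derivative (\<lambda>h. (h *\<^sub>R f') \<bullet> b)) (at t)" if b: "b \<in> Basis" for b
  proof -
    obtain i j where "b = axis i (axis j 1)"
      using b by (auto simp: Basis_vec_def)
    then show ?thesis
      using assms[of i j]
      by (simp add: inner_axis has_field_derivative_def mult.commute[of _ "f' $ i $ j"])
  qed
  then show ?thesis
    unfolding has_vector_derivative_def has_derivative_componentwise_within[of f] by blast
qed

lemma mat_exp_has_vector_derivative:
  "((\<lambda>t. mat_exp (t *\<^sub>R A)) has_vector_derivative (A ** mat_exp (t *\<^sub>R A))) (at t)"
proof (rule has_vector_derivative_matrixI)
  fix i j
  define P where "P q = ((**) A ^^ q) (mat 1)" for q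
  define c where "c i j q = P q $ i $ j / fact q" for i j q
  have sums: "(\<lambda>q. c i j q * t ^ q) sums (mat_exp (t *\<^sub>R A) $ i $ j)" for t i j
    using mat_exp_scaled_entry_sums[of A i j t] by (simp add: c_def P_def)
  \<comment> \<open>Differentiation shifts the coefficients: the factor \<open>Suc q\<close> cancels
    in the factorial, and \<open>P (Suc q)\<close> equals \<open>A ** P q\<close>.\<close>
  have "diffs (c i j) q = (\<Sum>k\<in>UNIV. A $ i $ k * c k j q)" for q
    by (simp add: diffs_def c_def P_def matrix_matrix_mult_def sum_divide_distrib
        sum_distrib_left field_simps del: of_nat_Suc)
  then have "(\<lambda>q. diffs (c i j) q * t ^ q) sums (\<Sum>k\<in>UNIV. A $ i $ k * mat_exp (t *\<^sub>R A) $ k $ j)"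
    by (simp add: sum_distrib_right mult.assoc) (intro sums_sum sums_mult sums)
  then have "(\<Sum>q. diffs (c i j) q * t ^ q) = (A ** mat_exp (t *\<^sub>R A)) $ i $ j"
    by (simp add: sums_iff matrix_matrix_mult_def)
  moreover have "(\<lambda>t. mat_exp (t *\<^sub>R A) $ i $ j) = (\<lambda>t. \<Sum>q. c i j q * t ^ q)"
    using sums by (simp add: sums_iff)
  ultimately show "((\<lambda>t. mat_exp (t *\<^sub>R A) $ i $ j) has_real_derivative
      (A ** mat_exp (t *\<^sub>R A)) $ i $ j) (at t)"
    using termdiffs_strong_converges_everywhere[of "c i j" t] sums by (simp add: sums_iff)
qed

lemma mat_exp_0 [simp]: "mat_exp 0 = mat 1"
proof (subst vec_eq_iff, intro allI, subst vec_eq_iff, intro allI)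
  fix i j
  show "mat_exp 0 $ i $ j = mat 1 $ i $ j"
    using sums_unique2[OF mat_exp_scaled_entry_sums[of 0 i j 0] powser_sums_zero] by simp
qed

text \<open>The solution at time \<open>t\<close> of the matrix differential equation
  \<open>Z' = lyap A Z\<close> with initial value \<open>Q\<close>.\<close>

definition lyap_flow :: "real^'s^'s \<Rightarrow> real \<Rightarrow> real^'s^'s \<Rightarrow> real^'s^'s" where
  "lyap_flow A t Q = mat_exp (t *\<^sub>R A) ** Q ** transpose (mat_exp (t *\<^sub>R A))"

lemma lyap_flow_0 [simp]: "lyap_flow A 0 Q = Q"
  by (simp add: lyap_flow_def)

lemma bounded_linear_lyap_flow: "bounded_linear (lyap_flow A t)"
  unfolding lyap_flow_def
  by (intro bounded_linear_compose[OF matrix_mult.bounded_linear_left matrix_mult.bounded_linear_right])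

lemma lyap_flow_has_vector_derivative:
  "((\<lambda>t. lyap_flow A t Q) has_vector_derivative lyap A (lyap_flow A t Q)) (at t)"
proof -
  let ?E = "\<lambda>t. mat_exp (t *\<^sub>R A)"
  have 1: "((\<lambda>t. ?E t ** Q) has_vector_derivative (A ** ?E t ** Q)) (at t)"
    using bounded_linear.has_vector_derivative[OF matrix_mult.bounded_linear_left[of Q]
        mat_exp_has_vector_derivative] by (simp add: matrix_mul_assoc)
  have 2: "((\<lambda>t. transpose (?E t)) has_vector_derivative transpose (A ** ?E t)) (at t)"
    by (rule bounded_linear.has_vector_derivative[OF bounded_linear_transpose
          mat_exp_has_vector_derivative])
  have "((\<lambda>t. ?E t ** Q ** transpose (?E t)) has_vector_derivative
      ?E t ** Q ** transpose (A ** ?E t) + A ** ?E t ** Q ** transpose (?E t)) (at t)"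
    by (rule matrix_mult.has_vector_derivative[OF 1 2])
  then show ?thesis
    by (simp add: lyap_flow_def lyap_def matrix_transpose_mul matrix_mul_assoc add.commute)
qed

lemma continuous_on_lyap_flow: "continuous_on S (\<lambda>t. lyap_flow A t Q)"
  by (rule continuous_at_imp_continuous_on)
    (use has_vector_derivative_continuous lyap_flow_has_vector_derivative in blast)

text \<open>An energy estimate: by coercivity, the squared norm of the flow weighted with
  \<open>exp (2 * c * t)\<close> has nonpositive derivative.\<close>

lemma norm_lyap_flow_le:
  assumes c: "\<And>X. c * (norm X)\<^sup>2 \<le> X \<bullet> - lyap A X" and "0 \<le> t"
  shows "norm (lyap_flow A t Q) \<le> exp (- c * t) * norm Q"
proof -
  let ?f = "\<lambda>t. exp (2 * c * t) * (norm (lyap_flow A t Q))\<^sup>2"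
  let ?f' = "\<lambda>t. exp (2 * c * t) * (2 * (c * (norm (lyap_flow A t Q))\<^sup>2 + lyap_flow A t Q \<bullet> lyap A (lyap_flow A t Q)))"
  have deriv: "(?f has_real_derivative ?f' s) (at s)" for s
  proof -
    have "((\<lambda>t. lyap_flow A t Q \<bullet> lyap_flow A t Q) has_real_derivative
        2 * (lyap_flow A s Q \<bullet> lyap A (lyap_flow A s Q))) (at s)"
      unfolding has_real_derivative_iff_has_vector_derivative
      using bounded_bilinear.has_vector_derivative[OF bounded_bilinear_inner
          lyap_flow_has_vector_derivative[of A Q s] lyap_flow_has_vector_derivative[of A Q s]]
      by (simp add: inner_commute)
    then show ?thesis
      unfolding power2_norm_eq_inner
      by (auto intro!: derivative_eq_intros simp: algebra_simps)
  qed
  have nonpos: "?f' s \<le> 0" for s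
    using c[of "lyap_flow A s Q"] by (simp add: mult_le_0_iff)
  have "?f t \<le> ?f 0"
    by (rule DERIV_nonpos_imp_nonincreasing[OF \<open>0 \<le> t\<close>]) (use deriv nonpos in blast)
  then have "exp (2 * c * t) * (norm (lyap_flow A t Q))\<^sup>2 \<le> (norm Q)\<^sup>2" by simp
  then have "(exp (- c * t))\<^sup>2 * (exp (2 * c * t) * (norm (lyap_flow A t Q))\<^sup>2) \<le> (exp (- c * t))\<^sup>2 * (norm Q)\<^sup>2"
    by (rule mult_left_mono) simp
  moreover have "(exp (- c * t))\<^sup>2 * exp (2 * c * t) = 1"
    by (simp add: power2_eq_square mult_exp_exp)
  ultimately have "(norm (lyap_flow A t Q))\<^sup>2 \<le> (exp (- c * t) * norm Q)\<^sup>2"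
    by (simp only: mult.assoc[symmetric] power_mult_distrib mult_1_left)
  then show ?thesis by (rule power2_le_imp_le) simp
qed

lemma integrable_exp_decay:
  fixes c :: real
  assumes "0 < c"
  shows "integrable lborel (\<lambda>t. indicator {0..} t *\<^sub>R exp (- c * t))"
proof -
  have "set_integrable lebesgue {0..} (\<lambda>t. exp (- c * t))"
    by (intro nonnegative_absolutely_integrable_1 integrable_on_exp_minus_to_infinity assms) simp
  then show ?thesis
    unfolding set_integrable_def by (subst (asm) integrable_completion) auto
qed

text \<open>The integrand after applying \<open>lyap A\<close> is the derivative of the flow. Its
  integral up to \<open>b\<close> is \<open>lyap_flow A b Q - Q\<close>, which tends to
  \<open>- Q\<close> by exponential decay.\<close>

lemma lyap_integral_lyap_flow:
  fixes A Q :: "real^'s^'s"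
  assumes pos: "\<And>X. X \<noteq> 0 \<Longrightarrow> 0 < X \<bullet> - lyap A X"
  shows "- lyap A (\<integral>t. indicator {0..} t *\<^sub>R lyap_flow A t Q \<partial>lborel) = Q"
proof -
  obtain c where c: "0 < c" "\<And>X. c * (norm X)\<^sup>2 \<le> X \<bullet> - lyap A X"
    using pos_form_coercive[OF linear_compose_neg[OF linear_lyap[of A]] pos] by blast
  let ?f = "\<lambda>t. indicator {0..} t *\<^sub>R lyap_flow A t Q"
  let ?g = "\<lambda>t. indicator {0..} t *\<^sub>R (exp (- c * t) * norm Q)"
  have g: "integrable lborel ?g"
    using integrable_exp_decay[OF c(1)] integrable_mult_left[of "norm Q" lborel "\<lambda>t. indicator {0..} t *\<^sub>R exp (- c * t)"]
    by (simp add: mult.assoc)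
  have [measurable]: "(\<lambda>t. lyap_flow A t Q) \<in> borel_measurable borel"
    by (intro borel_measurable_continuous_onI continuous_on_lyap_flow)
  have f: "integrable lborel ?f"
    by (rule Bochner_Integration.integrable_bound[OF g])
      (auto simp: indicator_def intro!: norm_lyap_flow_le[OF c(2), simplified])
  have bl: "bounded_linear (lyap A)" using linear_lyap by (simp add: linear_conv_bounded_linear)
  have "((\<lambda>t. norm (lyap_flow A t Q)) \<longlongrightarrow> 0) at_top"
  proof (rule tendsto_sandwich[OF _ _ tendsto_const])
    show "\<forall>\<^sub>F t in at_top. norm (lyap_flow A t Q) \<le> exp (- c * t) * norm Q"
      using eventually_ge_at_top[of 0] by eventually_elim (rule norm_lyap_flow_le[OF c(2)])
    have "((\<lambda>t. exp (- c * t)) \<longlongrightarrow> 0) at_top"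
      using c(1) by (intro filterlim_compose[OF exp_at_bot] filterlim_tendsto_neg_mult_at_bot[OF tendsto_const _ filterlim_ident]) simp
    then show "((\<lambda>t. exp (- c * t) * norm Q) \<longlongrightarrow> 0) at_top" by (rule tendsto_mult_left_zero)
  qed simp
  then have "((\<lambda>t. lyap_flow A t Q - Q) \<longlongrightarrow> 0 - Q) at_top"
    by (intro tendsto_diff tendsto_const) (rule tendsto_norm_zero_cancel)
  moreover have partial: "(\<integral>t. indicator {..b} t *\<^sub>R lyap A (?f t) \<partial>lborel) = lyap_flow A b Q - Q" if "0 \<le> b" for b
  proof -
    have "(\<integral>t. indicator {0..b} t *\<^sub>R lyap A (lyap_flow A t Q) \<partial>lborel) = lyap_flow A b Q - lyap_flow A 0 Q"
      by (rule integral_FTC_Icc[OF that has_vector_derivative_at_within[OF lyap_flow_has_vector_derivative]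
            bounded_linear.continuous_on[OF bl continuous_on_lyap_flow]])
    moreover have "indicator {0..b} t *\<^sub>R lyap A (lyap_flow A t Q) = indicator {..b} t *\<^sub>R lyap A (?f t)" for t
      by (simp add: indicator_def linear_0 linear_lyap)
    ultimately show ?thesis by simp
  qed
  have "\<forall>\<^sub>F b in at_top. lyap_flow A b Q - Q = (\<integral>t. indicator {..b} t *\<^sub>R lyap A (?f t) \<partial>lborel)"
    by (rule eventually_mono[OF eventually_ge_at_top[of 0]]) (simp only: partial)
  ultimately have "((\<lambda>b. \<integral>t. indicator {..b} t *\<^sub>R lyap A (?f t) \<partial>lborel) \<longlongrightarrow> 0 - Q) at_top"
    by (rule Lim_transform_eventually)
  moreover have "((\<lambda>b. \<integral>t. indicator {..b} t *\<^sub>R lyap A (?f t) \<partial>lborel) \<longlongrightarrow> (\<integral>t. lyap A (?f t) \<partial>lborel)) at_top"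
    by (intro tendsto_integral_at_top integrable_bounded_linear[OF bl f]) simp
  ultimately have "(\<integral>t. lyap A (?f t) \<partial>lborel) = - Q"
    using tendsto_unique[OF trivial_limit_at_top_linorder] by force
  then show "- lyap A (integral\<^sup>L lborel ?f) = Q"
    using integral_bounded_linear[OF bl f] by simp
qed

section \<open>The H2 norm as the trace of a Gramian\<close>

lemma outer_square_matrix_vector:
  "outer_square (M *v x) = M ** outer_square x ** transpose M"
  by (simp add: vec_eq_iff outer_square_def matrix_vector_mult_def matrix_matrix_mult_def
      transpose_def sum_product sum_distrib_right sum_distrib_left ac_simps)

lemma sum_outer_square_columns: "(\<Sum>l\<in>UNIV. outer_square (column l B)) = B ** transpose B"
  by (simp add: vec_eq_iff outer_square_def column_def matrix_matrix_mult_def transpose_def)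

lemma sum_lists_length_Suc:
  fixes f :: "'m::finite list \<Rightarrow> 'b::comm_monoid_add"
  shows "(\<Sum>ls | length ls = Suc i. f ls) = (\<Sum>l\<in>UNIV. \<Sum>ls | length ls = i. f (l # ls))"
proof -
  have "{ls :: 'm list. length ls = Suc i} = (\<lambda>(l, ls). l # ls) ` (UNIV \<times> {ls. length ls = i})"
    by (auto simp: length_Suc_conv image_iff)
  moreover have "inj_on (\<lambda>(l, ls). l # ls) (UNIV \<times> {ls :: 'm list. length ls = i})"
    by (auto simp: inj_on_def)
  ultimately show ?thesis
    by (simp add: sum.reindex sum.cartesian_product o_def case_prod_unfold)
qed

text \<open>Sums the outer squares of the state kernels over all index words of length
  \<open>i\<close> by an operator recursion. Words of length \<open>i\<close> use
  \<open>i + 1\<close> times, so the newest time at \<open>Suc i\<close> is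
  \<open>s (i + 2)\<close>.\<close>

fun kernel_gram ::
  "real^'s^'s \<Rightarrow> real^'s^'s^'m \<Rightarrow> real^'s^'s \<Rightarrow> nat \<Rightarrow> (nat \<Rightarrow> real) \<Rightarrow> real^'s^'s" where
  "kernel_gram A N Q 0 s = lyap_flow A (s 1) Q"
| "kernel_gram A N Q (Suc i) s = lyap_flow A (s (i + 2)) (coupling N (kernel_gram A N Q i s))"

text \<open>A longer word splits into head and tail; the sum over the head is
  \<open>coupling\<close>, and linearity moves the sum over the tail inside.\<close>

lemma kernel_gram_eq_sum:
  "kernel_gram A N (B ** transpose B) i s
    = (\<Sum>ls | length ls = i. \<Sum>l\<in>UNIV. outer_square (state_kernel A N (column l B) ls s))"
proof (induction i)
  case 0
  have "kernel_gram A N (B ** transpose B) 0 s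
      = (\<Sum>l\<in>UNIV. outer_square (mat_exp (s 1 *\<^sub>R A) *v column l B))"
    by (simp add: lyap_flow_def outer_square_matrix_vector matrix_mult.sum_left
        matrix_mult.sum_right flip: sum_outer_square_columns)
  then show ?case by simp
next
  case (Suc i)
  have "outer_square (state_kernel A N (column k B) (l # ls) s)
      = lyap_flow A (s (i + 2)) (N $ l ** outer_square (state_kernel A N (column k B) ls s) ** transpose (N $ l))"
    if "length ls = i" for k l ls
    using that by (simp add: outer_square_matrix_vector lyap_flow_def)
  then have "(\<Sum>ls | length ls = Suc i. \<Sum>k\<in>UNIV. outer_square (state_kernel A N (column k B) ls s))
      = (\<Sum>l\<in>UNIV. \<Sum>ls | length ls = i. \<Sum>k\<in>UNIV.
          lyap_flow A (s (i + 2)) (N $ l ** outer_square (state_kernel A N (column k B) ls s) ** transpose (N $ l)))"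
    unfolding sum_lists_length_Suc by (intro sum.cong) auto
  also have "\<dots> = lyap_flow A (s (i + 2)) (coupling N (kernel_gram A N (B ** transpose B) i s))"
    by (simp add: Suc coupling_def matrix_mult.sum_left matrix_mult.sum_right
        linear_sum[OF bounded_linear.linear[OF bounded_linear_lyap_flow]])
  finally show ?case by simp
qed

lemma h2_integrand_eq_kernel_gram:
  "h2_integrand (A, N, B, C) (Suc i) s = C ** kernel_gram A N (B ** transpose B) i s ** transpose C"
  by (simp add: kernel_gram_eq_sum outer_square_matrix_vector matrix_mult.sum_left matrix_mult.sum_right)

text \<open>Only the times \<open>1\<close> to \<open>Suc i\<close> are read, so the next time
  variable can be integrated separately.\<close>

lemma kernel_gram_fun_upd:
  assumes "Suc i < k"
  shows "kernel_gram A N Q i (s(k := y)) = kernel_gram A N Q i s"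
  using assms by (induction i) auto

text \<open>Factors the indicator over the time variables. Extensionality is the part of membership
  in the domain that the factors cannot detect.\<close>

lemma indicator_time_domain:
  assumes "s \<in> extensional {1..j}"
  shows "indicator (time_domain j) s = (\<Prod>k\<in>{1..j}. indicator {0..} (s k) :: real)"
proof (cases "s \<in> time_domain j")
  case True
  then have "s k \<in> {0..}" if "k \<in> {1..j}" for k using that by (auto simp: PiE_def)
  then show ?thesis using True by simp
next
  case False
  then obtain k where "k \<in> {1..j}" "s k \<notin> {0..}" using assms by (auto simp: PiE_def Pi_def)
  then have "(\<Prod>k\<in>{1..j}. indicator {0..} (s k) :: real) = 0"
    by (intro prod_zero) (auto intro!: bexI[of _ k])
  then show ?thesis using False by simp
qed

lemma time_domain_measurable [measurable]: "time_domain j \<in> sets (time_measure j)"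
  by (intro sets_PiM_I_finite) auto

lemma kernel_gram_measurable:
  assumes "Suc i \<le> j"
  shows "kernel_gram A N Q i \<in> borel_measurable (time_measure j)"
proof -
  have mult: "(\<lambda>s. f s ** g s) \<in> borel_measurable M"
    if "f \<in> borel_measurable M" "g \<in> borel_measurable M" for f g :: "(nat \<Rightarrow> real) \<Rightarrow> real^'s^'s" and M
    using that by (rule borel_measurable_continuous_Pair)
      (intro continuous_intros bounded_bilinear.continuous_on[OF bounded_bilinear_matrix_mult])
  have "(\<lambda>t. mat_exp (t *\<^sub>R A)) \<in> borel_measurable borel"
    by (intro borel_measurable_continuous_onI continuous_at_imp_continuous_on ballI
        has_vector_derivative_continuous[OF mat_exp_has_vector_derivative])
  then have E: "(\<lambda>s. mat_exp (s k *\<^sub>R A)) \<in> borel_measurable (time_measure j)"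
    if "k \<in> {1..j}" for k
    using that by measurable
  have bl: "(\<lambda>s. L (f s)) \<in> borel_measurable M"
    if "bounded_linear L" "f \<in> borel_measurable M"
    for L :: "real^'s^'s \<Rightarrow> real^'s^'s" and f :: "(nat \<Rightarrow> real) \<Rightarrow> real^'s^'s" and M
    by (rule borel_measurable_continuous_on[OF linear_continuous_on[OF that(1)] that(2)])
  have flow: "(\<lambda>s. lyap_flow A (s k) (f s)) \<in> borel_measurable (time_measure j)"
    if "k \<in> {1..j}" "f \<in> borel_measurable (time_measure j)" for k f
    unfolding lyap_flow_def
    by (intro mult E bl[OF bounded_linear_transpose] that)
  show ?thesis
    using assms
  proof (induction i)
    case 0
    then show ?case using flow[of 1 "\<lambda>_. Q"] by simp
  next
    case (Suc i)
    then show ?case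
      using flow[of "i + 2" "\<lambda>s. coupling N (kernel_gram A N Q i s)"]
        bl[of "coupling N" "kernel_gram A N Q i"] linear_coupling[of N]
      by (simp add: linear_conv_bounded_linear)
  qed
qed

text \<open>Each flow contributes a factor \<open>exp (- c * s k)\<close> and each coupling a
  constant, so the kernel is dominated by an integrable product of one-variable functions.\<close>

lemma integrable_kernel_gram:
  assumes pos: "\<And>X. X \<noteq> 0 \<Longrightarrow> 0 < X \<bullet> - lyap A X"
  shows "set_integrable (time_measure (Suc i)) (time_domain (Suc i)) (kernel_gram A N Q i)"
proof -
  interpret product_sigma_finite "\<lambda>_::nat. lborel :: real measure" by standard
  obtain c where c: "0 < c" "\<And>X. c * (norm X)\<^sup>2 \<le> X \<bullet> - lyap A X"
    using pos_form_coercive[OF linear_compose_neg[OF linear_lyap[of A]] pos] by blast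
  note flow_le = norm_lyap_flow_le[OF c(2)]
  have "\<exists>K\<ge>0. \<forall>s. (\<forall>k\<in>{1..Suc i}. 0 \<le> s k) \<longrightarrow>
      norm (kernel_gram A N Q i s) \<le> K * (\<Prod>k\<in>{1..Suc i}. exp (- c * s k))"
  proof (induction i)
    case 0
    show ?case
      by (rule exI[of _ "norm Q"]) (use flow_le[of "_ 1"] in \<open>auto simp: mult.commute[of "norm Q"]\<close>)
  next
    case (Suc i)
    then obtain K where K: "0 \<le> K" "\<And>s. (\<forall>k\<in>{1..Suc i}. 0 \<le> s k) \<Longrightarrow>
      norm (kernel_gram A N Q i s) \<le> K * (\<Prod>k\<in>{1..Suc i}. exp (- c * s k))" by blast
    obtain M where M: "0 < M" "\<And>X. norm (coupling N X) \<le> norm X * M"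
      using bounded_linear.pos_bounded linear_conv_bounded_linear linear_coupling by blast
    have "norm (kernel_gram A N Q (Suc i) s) \<le> (K * M) * (\<Prod>k\<in>{1..Suc (Suc i)}. exp (- c * s k))"
      if s: "\<forall>k\<in>{1..Suc (Suc i)}. 0 \<le> s k" for s
    proof -
      have "norm (kernel_gram A N Q (Suc i) s)
          \<le> exp (- c * s (i + 2)) * norm (coupling N (kernel_gram A N Q i s))"
        using flow_le[of "s (i + 2)"] s by simp
      also have "\<dots> \<le> exp (- c * s (i + 2)) * ((K * (\<Prod>k\<in>{1..Suc i}. exp (- c * s k))) * M)"
        using s M by (intro mult_left_mono order_trans[OF M(2)] mult_right_mono K(2)) auto
      finally show ?thesis by (simp add: mult_ac)
    qed
    then show ?case using K(1) M(1) by (intro exI[of _ "K * M"]) auto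
  qed
  then obtain K where K: "0 \<le> K" "\<And>s. (\<forall>k\<in>{1..Suc i}. 0 \<le> s k) \<Longrightarrow>
      norm (kernel_gram A N Q i s) \<le> K * (\<Prod>k\<in>{1..Suc i}. exp (- c * s k))" by blast
  have "integrable (time_measure (Suc i))
      (\<lambda>s. K * (\<Prod>k\<in>{1..Suc i}. indicator {0..} (s k) *\<^sub>R exp (- c * s k)))"
    by (intro integrable_mult_right product_integrable_prod integrable_exp_decay c(1)) simp
  then show ?thesis
    unfolding set_integrable_def
  proof (rule Bochner_Integration.integrable_bound)
    show "(\<lambda>s. indicator (time_domain (Suc i)) s *\<^sub>R kernel_gram A N Q i s)
        \<in> borel_measurable (time_measure (Suc i))"
      using kernel_gram_measurable[of i "Suc i" A N Q] by measurable
    show "AE s in time_measure (Suc i). norm (indicator (time_domain (Suc i)) s *\<^sub>R kernel_gram A N Q i s)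
        \<le> norm (K * (\<Prod>k\<in>{1..Suc i}. indicator {0..} (s k) *\<^sub>R exp (- c * s k)))"
    proof (rule AE_I2)
      fix s assume "s \<in> space (time_measure (Suc i))"
      then have "s \<in> extensional {1..Suc i}" by (auto simp: space_PiM PiE_def)
      show "norm (indicator (time_domain (Suc i)) s *\<^sub>R kernel_gram A N Q i s)
          \<le> norm (K * (\<Prod>k\<in>{1..Suc i}. indicator {0..} (s k) *\<^sub>R exp (- c * s k)))"
      proof (cases "s \<in> time_domain (Suc i)")
        case True
        then have s: "\<forall>k\<in>{1..Suc i}. 0 \<le> s k" by (auto simp: PiE_def)
        have eq: "(\<Prod>k\<in>{1..Suc i}. indicator {0..} (s k) *\<^sub>R exp (- c * s k)) = (\<Prod>k\<in>{1..Suc i}. exp (- c * s k))"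
          using s by (intro prod.cong) auto
        show ?thesis
          unfolding eq using K(1) K(2)[OF s] True by (simp add: abs_mult prod_nonneg)
      qed simp
    qed
  qed
qed

text \<open>The contribution of the words of length \<open>i\<close> to the controllability Gramian;
  the output matrix is applied only later.\<close>

definition gram_term :: "real^'s^'s \<Rightarrow> real^'s^'s^'m \<Rightarrow> real^'s^'s \<Rightarrow> nat \<Rightarrow> real^'s^'s" where
  "gram_term A N Q i =
    set_lebesgue_integral (time_measure (Suc i)) (time_domain (Suc i)) (kernel_gram A N Q i)"

text \<open>Fubini with the last time variable innermost: in \<open>kernel_gram\<close> that
  variable enters only through the outermost flow.\<close>

lemma time_integral_Suc:
  fixes g :: "(nat \<Rightarrow> real) \<Rightarrow> 'b::{banach, second_countable_topology}"
  assumes "set_integrable (time_measure (Suc j)) (time_domain (Suc j)) g"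
  shows "set_lebesgue_integral (time_measure (Suc j)) (time_domain (Suc j)) g
    = (\<integral>x. indicator (time_domain j) x *\<^sub>R (\<integral>y. indicator {0..} y *\<^sub>R g (x(Suc j := y)) \<partial>lborel) \<partial>time_measure j)"
proof -
  interpret product_sigma_finite "\<lambda>_::nat. lborel :: real measure" by standard
  have ins: "insert (Suc j) {1..j} = {1..Suc j}" by auto
  let ?f = "\<lambda>s. indicator (time_domain (Suc j)) s *\<^sub>R g s"
  have "set_lebesgue_integral (time_measure (Suc j)) (time_domain (Suc j)) g
      = (\<integral>x. (\<integral>y. ?f (x(Suc j := y)) \<partial>lborel) \<partial>time_measure j)"
    using product_integral_insert[of "{1..j}" "Suc j" ?f] assms
    unfolding ins set_integrable_def set_lebesgue_integral_def by simp
  also have "\<dots> = (\<integral>x. indicator (time_domain j) x *\<^sub>R (\<integral>y. indicator {0..} y *\<^sub>R g (x(Suc j := y)) \<partial>lborel) \<partial>time_measure j)"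
  proof (rule Bochner_Integration.integral_cong[OF refl])
    fix x assume "x \<in> space (time_measure j)"
    then have x: "x \<in> extensional {1..j}" by (auto simp: space_PiM PiE_def)
    then have "x(Suc j := y) \<in> extensional {1..Suc j}" for y by (auto simp: extensional_def)
    note ind = indicator_time_domain[OF this]
    have "indicator (time_domain (Suc j)) (x(Suc j := y))
        = indicator (time_domain j) x * (indicator {0..} y :: real)" for y
    proof -
      have "(\<Prod>k\<in>{1..j}. indicator {0..} ((x(Suc j := y)) k) :: real) = (\<Prod>k\<in>{1..j}. indicator {0..} (x k))"
        by (intro prod.cong) auto
      then show ?thesis unfolding ind indicator_time_domain[OF x] by simp
    qed
    then show "(\<integral>y. ?f (x(Suc j := y)) \<partial>lborel)
        = indicator (time_domain j) x *\<^sub>R (\<integral>y. indicator {0..} y *\<^sub>R g (x(Suc j := y)) \<partial>lborel)"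
      by (simp flip: scaleR_scaleR)
  qed
  finally show ?thesis .
qed

text \<open>Integrating out the last time variable applies \<open>J\<close>, the inverse of
  \<open>- lyap A\<close>. As a bounded linear map it commutes with the remaining integrals, which
  leaves the preceding Gramian term.\<close>

lemma gram_term_recursion:
  assumes pos: "\<And>X. X \<noteq> 0 \<Longrightarrow> 0 < X \<bullet> - lyap A X"
  shows "- lyap A (gram_term A N Q 0) = Q"
    and "- lyap A (gram_term A N Q (Suc i)) = coupling N (gram_term A N Q i)"
proof -
  define J where "J X = (\<integral>t. indicator {0..} t *\<^sub>R lyap_flow A t X \<partial>lborel)" for X
  have GJ: "- lyap A (J X) = X" for X unfolding J_def by (rule lyap_integral_lyap_flow[OF pos])
  have lin: "linear (\<lambda>X. - lyap A X)" by (rule linear_compose_neg[OF linear_lyap])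
  have "inj (\<lambda>X. - lyap A X)" by (rule pos_form_injective[OF lin pos])
  \<comment> \<open>Recognizing \<open>J\<close> as the inverse of an injective linear map yields
    its linearity and boundedness.\<close>
  then have "inv (\<lambda>X. - lyap A X) = J" by (metis (no_types, lifting) GJ inv_f_eq ext)
  then have blJ: "bounded_linear J"
    using inj_linear_imp_inv_linear[OF lin \<open>inj _\<close>] by (simp add: linear_conv_bounded_linear)
  \<comment> \<open>After one variable is split off, the outer integral runs over the one-point
    product space with no factors.\<close>
  have "gram_term A N Q 0 = J Q"
    using time_integral_Suc[OF integrable_kernel_gram[OF pos, of 0 N Q]]
    by (simp add: gram_term_def PiM_empty lebesgue_integral_count_space_finite J_def)
  then show "- lyap A (gram_term A N Q 0) = Q" by (simp only: GJ)
  have int: "integrable (time_measure (Suc i)) (\<lambda>x. indicator (time_domain (Suc i)) x *\<^sub>R kernel_gram A N Q i x)"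
    using integrable_kernel_gram[OF pos] by (simp add: set_integrable_def)
  have bl: "bounded_linear (\<lambda>X. J (coupling N X))"
    by (intro bounded_linear_compose[OF blJ]) (use linear_coupling linear_conv_bounded_linear in blast)
  have "gram_term A N Q (Suc i)
      = (\<integral>x. indicator (time_domain (Suc i)) x *\<^sub>R J (coupling N (kernel_gram A N Q i x)) \<partial>time_measure (Suc i))"
    using time_integral_Suc[OF integrable_kernel_gram[OF pos, of "Suc i" N Q]]
    by (simp add: gram_term_def J_def kernel_gram_fun_upd)
  also have "\<dots> = (\<integral>x. J (coupling N (indicator (time_domain (Suc i)) x *\<^sub>R kernel_gram A N Q i x)) \<partial>time_measure (Suc i))"
    by (simp only: linear_cmul[OF bounded_linear.linear[OF bl]])
  also have "\<dots> = J (coupling N (gram_term A N Q i))"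
    unfolding gram_term_def set_lebesgue_integral_def by (rule integral_bounded_linear[OF bl int])
  finally show "- lyap A (gram_term A N Q (Suc i)) = coupling N (gram_term A N Q i)"
    by (simp only: GJ)
qed

text \<open>The terms of the H2 series are \<open>gram_term\<close> conjugated by \<open>C\<close>.
  Their recursion is that of the Neumann series for \<open>M_op A N P = B ** transpose B\<close>,
  which converges by domination.\<close>

lemma h2_norm_eq_trace_gramian:
  fixes A P :: "real^'s^'s" and N :: "real^'s^'s^'m" and B :: "real^'r^'s" and C :: "real^'s^'p"
  assumes N_sym: "\<And>i. transpose (N $ i) = N $ i"
    and dom: "coupling_dominated A N" and P: "M_op A N P = B ** transpose B"
  shows "h2_defined (A, N, B, C)"
    and "h2_norm (A, N, B, C) = sqrt (trace (C ** P ** transpose C))"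
proof -
  let ?Q = "B ** transpose B" and ?c = "\<lambda>X. C ** X ** transpose C"
  have dom': "\<bar>X \<bullet> coupling N X\<bar> < X \<bullet> - lyap A X" if "X \<noteq> 0" for X
    using dom that by (simp add: coupling_dominated_def)
  have pos: "0 < X \<bullet> - lyap A X" if "X \<noteq> 0" for X
    using dom'[OF that] by linarith
  have blc: "bounded_linear ?c"
    by (intro bounded_linear_compose[OF matrix_mult.bounded_linear_left matrix_mult.bounded_linear_right])
  have int: "integrable (time_measure (Suc i)) (\<lambda>x. indicator (time_domain (Suc i)) x *\<^sub>R kernel_gram A N ?Q i x)" for i
    using integrable_kernel_gram[OF pos] by (simp add: set_integrable_def)
  have ind: "indicator (time_domain (Suc i)) x *\<^sub>R h2_integrand (A, N, B, C) (Suc i) x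
      = ?c (indicator (time_domain (Suc i)) x *\<^sub>R kernel_gram A N ?Q i x)" for i x
    unfolding h2_integrand_eq_kernel_gram
    by (simp only: linear_cmul[OF bounded_linear.linear[OF blc]])
  have "set_integrable (time_measure (Suc i)) (time_domain (Suc i)) (h2_integrand (A, N, B, C) (Suc i))" for i
    unfolding set_integrable_def ind by (rule integrable_bounded_linear[OF blc int])
  then have integrable: "set_integrable (time_measure j) (time_domain j) (h2_integrand (A, N, B, C) j)" if "1 \<le> j" for j
    using that by (cases j) auto
  have "h2_term (A, N, B, C) (Suc i) = ?c (gram_term A N ?Q i)" for i
    unfolding h2_term_def gram_term_def set_lebesgue_integral_def ind
    by (rule integral_bounded_linear[OF blc int])
  moreover have "gram_term A N ?Q sums P"
    by (rule dominated_iteration_sums[OF linear_compose_neg[OF linear_lyap] linear_coupling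
          coupling_selfadjoint[OF N_sym] dom' gram_term_recursion(1)[OF pos]
          gram_term_recursion(2)[OF pos]])
      (use P in \<open>simp_all add: M_op_def\<close>)
  ultimately have "(\<lambda>i. h2_term (A, N, B, C) (Suc i)) sums ?c P"
    using bounded_linear.sums[OF blc] by simp
  with integrable show "h2_defined (A, N, B, C)"
    "h2_norm (A, N, B, C) = sqrt (trace (C ** P ** transpose C))"
    by (auto simp: h2_defined_def h2_norm_def sums_iff)
qed

section \<open>The error system\<close>

text \<open>With \<open>inr_rows\<close>, one of the two coordinate embeddings into the direct sum.
  Through them block matrices become products and sums, without entrywise case distinctions.\<close>

definition inl_rows :: "real^'n^('n::finite + 'k::finite)" where
  "inl_rows = stack_rows (mat 1) 0"

definition inr_rows :: "real^'k^('n::finite + 'k::finite)" where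
  "inr_rows = stack_rows 0 (mat 1)"

lemma sum_UNIV_plus:
  "(\<Sum>a\<in>UNIV. f a) = (\<Sum>i\<in>UNIV. f (Inl i)) + (\<Sum>j\<in>UNIV. f (Inr j))"
  for f :: "'n::finite + 'k::finite \<Rightarrow> 'b::comm_monoid_add"
  using sum.Plus[of UNIV UNIV f] by (simp add: o_def)

lemmas rows_simps = vec_eq_iff inl_rows_def inr_rows_def stack_rows_def transpose_def
  matrix_matrix_mult_def mat_def sum_UNIV_plus split_sum_all sum.delta sum.delta'
  if_distrib[of "\<lambda>x. x * c" for c] if_distrib[of "\<lambda>x. c * x" for c]

lemma inl_rows_orth [simp]: "transpose inl_rows ** inl_rows = mat 1"
  by (simp add: rows_simps cong: if_cong)

lemma inr_rows_orth [simp]: "transpose inr_rows ** inr_rows = mat 1"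
  by (simp add: rows_simps cong: if_cong)

lemma inl_inr_rows_orth [simp]: "transpose inl_rows ** inr_rows = 0"
  by (simp add: rows_simps cong: if_cong)

lemma inr_inl_rows_orth [simp]: "transpose inr_rows ** inl_rows = 0"
  by (simp add: rows_simps cong: if_cong)

lemma rows_complete: "(inl_rows :: real^'n^('n::finite + 'k::finite)) ** transpose inl_rows
    + inr_rows ** transpose inr_rows = mat 1"
  by (simp add: rows_simps cong: if_cong)

lemma block_diag_eq:
  "block_diag P Q = inl_rows ** P ** transpose inl_rows + inr_rows ** Q ** transpose inr_rows"
  by (simp add: rows_simps block_diag_def cong: if_cong)

lemma stack_rows_eq: "stack_rows P Q = inl_rows ** P + inr_rows ** Q"
  by (simp add: rows_simps cong: if_cong)

lemma join_columns_eq: "join_columns P Q = P ** transpose inl_rows + Q ** transpose inr_rows"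
  by (simp add: rows_simps join_columns_def cong: if_cong)

lemma inner_sandwich: "(U ** R) \<bullet> (P ** (U' ** S)) = R \<bullet> (transpose U ** P ** U' ** S)"
  for U :: "real^'n^'m"
  by (simp only: inner_matrix_mult_left matrix_mul_assoc)

text \<open>The rectangular analogue of \<open>M_op\<close> that governs the mixed block of the
  Gramian of a block diagonal system.\<close>

definition sylv_op ::
  "real^'s^'s \<Rightarrow> real^'s^'s^'m \<Rightarrow> real^'t^'t \<Rightarrow> real^'t^'t^'m \<Rightarrow> real^'t^'s \<Rightarrow> real^'t^'s" where
  "sylv_op A N A' N' Z =
    - (A ** Z + Z ** transpose A') - (\<Sum>i\<in>UNIV. N $ i ** Z ** transpose (N' $ i))"

lemma sylv_op_same [simp]: "sylv_op A N A N = M_op A N"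
  by (simp add: fun_eq_iff sylv_op_def M_op_def lyap_def coupling_def)

lemma M_op_transpose: "M_op A N (transpose Z) = transpose (M_op A N Z)"
  by (simp add: M_op_def lyap_def coupling_def transpose_diff transpose_add transpose_sum
      linear_neg[OF linear_transpose] matrix_transpose_mul matrix_mul_assoc)

lemma M_op_eq_iff: "M_op A N X = Q \<longleftrightarrow> lyap A X + coupling N X + Q = 0"
  by (auto simp: M_op_def add_eq_0_iff)

text \<open>When \<open>transpose U\<close> and \<open>transpose U'\<close> intertwine a large
  system with two smaller ones, cutting a block out of the large Gramian equation gives a closed
  equation for that block.\<close>

lemma sylv_op_intertwine:
  assumes "transpose U ** A = A1 ** transpose U" "\<And>i. transpose U ** N $ i = N1 $ i ** transpose U"
    and "transpose U' ** A = A2 ** transpose U'" "\<And>i. transpose U' ** N $ i = N2 $ i ** transpose U'"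
  shows "sylv_op A1 N1 A2 N2 (transpose U ** Z ** U') = transpose U ** M_op A N Z ** U'"
proof -
  have right: "transpose A ** U' = U' ** transpose A2"
    "transpose (N $ i) ** U' = U' ** transpose (N2 $ i)" for i
    using arg_cong[OF assms(3), of transpose] arg_cong[OF assms(4), of transpose]
    by (simp_all add: matrix_transpose_mul)
  have "transpose U ** (A ** Z) ** U' = A1 ** (transpose U ** Z ** U')"
    by (simp add: matrix_mul_assoc assms(1))
  moreover have "transpose U ** (Z ** transpose A) ** U' = transpose U ** Z ** U' ** transpose A2"
    by (simp add: right flip: matrix_mul_assoc)
  moreover have "transpose U ** (N $ i ** Z ** transpose (N $ i)) ** U'
      = N1 $ i ** (transpose U ** Z ** U') ** transpose (N2 $ i)" for i
  proof -
    have "transpose U ** (N $ i ** Z ** transpose (N $ i)) ** U'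
        = transpose U ** N $ i ** Z ** (transpose (N $ i) ** U')"
      by (simp add: matrix_mul_assoc)
    then show ?thesis by (simp add: assms(2) right matrix_mul_assoc)
  qed
  ultimately show ?thesis
    by (simp add: sylv_op_def M_op_def lyap_def coupling_def matrix_mult.diff_left
        matrix_mult.diff_right matrix_mult.minus_left matrix_mult.minus_right matrix_mult.add_right
        matrix_mult.add_left matrix_mult.sum_left matrix_mult.sum_right)
qed

section \<open>Galerkin projections and their energies\<close>

definition proj_mat :: "real^'k^'n \<Rightarrow> real^'n^'n \<Rightarrow> real^'k^'k" where
  "proj_mat W A = transpose W ** A ** W"

definition proj_coupling :: "real^'k^'n \<Rightarrow> real^'n^'n^'m \<Rightarrow> real^'k^'k^'m" where
  "proj_coupling W N = (\<chi> i. proj_mat W (N $ i))"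

lemma transpose_proj_mat: "transpose (proj_mat W A) = proj_mat W (transpose A)"
  by (simp add: proj_mat_def matrix_transpose_mul matrix_mul_assoc)

text \<open>The value \<open>t = 1\<close> gives the projected system itself; varying
  \<open>t\<close> perturbs only its output matrix.\<close>

definition galerkin_output_scaled ::
  "real^'n^'n \<Rightarrow> real^'n^'n^'m \<Rightarrow> real^'r^'n \<Rightarrow> real^'k^'n \<Rightarrow> real
    \<Rightarrow> ('k::finite, 'm::finite, 'r::finite, 'r) bilinear_system" where
  "galerkin_output_scaled A N B W t =
    (proj_mat W A, proj_coupling W N, transpose W ** B, t *\<^sub>R transpose (transpose W ** B))"

locale symmetric_bilinear =
  fixes A :: "real^'n^'n" and N :: "real^'n^'n^'m" and B :: "real^'r^'n"
  assumes A_sym: "transpose A = A" and N_sym: "\<And>i. transpose (N $ i) = N $ i"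
    and dom: "coupling_dominated A N"

locale galerkin = symmetric_bilinear A N B
  for A :: "real^'n^'n" and N :: "real^'n^'n^'m" and B :: "real^'r^'n" +
  fixes W :: "real^'k^'n"
  assumes orth: "transpose W ** W = mat 1"
begin

abbreviation "Ah \<equiv> proj_mat W A"
abbreviation "Nh \<equiv> proj_coupling W N"
abbreviation "Bh \<equiv> transpose W ** B"

lemma Ah_sym: "transpose Ah = Ah"
  by (simp add: transpose_proj_mat A_sym)

lemma Nh_sym: "transpose (Nh $ i) = Nh $ i"
  by (simp add: proj_coupling_def transpose_proj_mat N_sym)

text \<open>A Galerkin projection is a compression with one block, indexed by
  \<open>unit\<close>.\<close>

lemma dom_projected: "coupling_dominated Ah Nh"
proof -
  interpret compression "\<lambda>_::unit. W"
    by unfold_locales (simp add: UNIV_unit orth)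
  have "proj_mat W M = compress M" for M by (simp add: compress_def proj_mat_def UNIV_unit)
  then show ?thesis
    using coupling_dominated_compress[OF dom, of Nh] by (simp add: proj_coupling_def)
qed

text \<open>Domination passes to the projected system, so its equation is uniquely solvable and the
  definite description denotes the solution.\<close>

lemma projected_solution_iff:
  "projected_solution A N B W = Y \<longleftrightarrow> M_op Ah Nh Y = Bh ** transpose Bh"
proof -
  have eqn: "(transpose W ** A ** W) ** Y + Y ** (transpose W ** A ** W)
     + (\<Sum>i\<in>UNIV. (transpose W ** N $ i ** W) ** Y ** (transpose W ** N $ i ** W))
     + transpose W ** B ** transpose B ** W = 0 \<longleftrightarrow> M_op Ah Nh Y = Bh ** transpose Bh" for Y
    using Ah_sym Nh_sym
    by (simp add: M_op_eq_iff lyap_def coupling_def proj_coupling_def matrix_transpose_mul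
        matrix_mul_assoc flip: proj_mat_def)
  note unique = M_op_unique_solution[OF dom_projected, of "Bh ** transpose Bh"]
  show ?thesis
    unfolding projected_solution_def eqn
    using the1_equality[OF unique] theI'[OF unique] by blast
qed

abbreviation "Xh \<equiv> projected_solution A N B W"

lemma M_op_Xh: "M_op Ah Nh Xh = Bh ** transpose Bh"
  using projected_solution_iff by blast

text \<open>Shows that \<open>sylv_op\<close> is the restriction of the form of \<open>M_op\<close>
  to the matrices \<open>Z ** transpose W\<close>.\<close>

lemma M_op_lift_right: "M_op A N (Z ** transpose W) ** W = sylv_op A N Ah Nh Z"
  unfolding M_op_def lyap_def coupling_def sylv_op_def Ah_sym Nh_sym A_sym N_sym
  unfolding proj_coupling_def proj_mat_def
  by (simp add: matrix_mult.diff_left matrix_mult.minus_left matrix_mult.add_left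
      matrix_mult.sum_left orth flip: matrix_mul_assoc)

lemma M_op_lift_both: "transpose W ** M_op A N (W ** Z ** transpose W) ** W = M_op Ah Nh Z"
proof -
  have "transpose W ** M_op A N (W ** Z ** transpose W) ** W = transpose W ** sylv_op A N Ah Nh (W ** Z)"
    using M_op_lift_right[of "W ** Z"] by (simp flip: matrix_mul_assoc)
  also have "\<dots> = M_op Ah Nh Z"
    unfolding sylv_op_same[symmetric] sylv_op_def proj_coupling_def proj_mat_def
    by (simp add: matrix_mult.diff_right matrix_mult.minus_right matrix_mult.add_right
        matrix_mult.sum_right matrix_mul_assoc orth)
  finally show ?thesis .
qed

lemma inner_lift: "(W ** Z ** transpose W) \<bullet> M = Z \<bullet> (transpose W ** M ** W)"
  using inner_matrix_mult_left[of W "Z ** transpose W" M]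
    inner_matrix_mult_right[of Z "transpose W" "transpose W ** M"]
  by (simp add: matrix_mul_assoc)

text \<open>Galerkin orthogonality: the lifted solution has the same \<open>M\<close>-inner product
  with \<open>X\<close> as with itself, so by Pythagoras the squared error is the difference of the
  energies.\<close>

lemma M_norm_galerkin_error:
  assumes X: "M_op A N X = B ** transpose B"
  shows "M_norm A N (X - W ** Xh ** transpose W) = sqrt (B \<bullet> (X ** B) - Bh \<bullet> (Xh ** Bh))"
proof -
  let ?G = "W ** Xh ** transpose W"
  have b: "Xh \<bullet> (Bh ** transpose Bh) = Bh \<bullet> (Xh ** Bh)"
    using inner_matrix_mult_right[of Xh Bh Bh] by (simp add: inner_commute)
  have XX: "X \<bullet> M_op A N X = B \<bullet> (X ** B)"
    using inner_matrix_mult_right[of X B B] by (simp add: X inner_commute)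
  have GX: "?G \<bullet> M_op A N X = Bh \<bullet> (Xh ** Bh)"
  proof -
    have "transpose W ** (B ** transpose B) ** W = Bh ** transpose Bh"
      by (simp add: matrix_transpose_mul matrix_mul_assoc)
    then show ?thesis by (simp only: inner_lift X b)
  qed
  have GG: "?G \<bullet> M_op A N ?G = Bh \<bullet> (Xh ** Bh)"
    by (simp only: inner_lift M_op_lift_both M_op_Xh b)
  have "M_inner A N (X - ?G) (X - ?G) = (X - ?G) \<bullet> M_op A N (X - ?G)"
    by (simp add: M_inner_def inner_matrix_eq_trace)
  also have "\<dots> = B \<bullet> (X ** B) - Bh \<bullet> (Xh ** Bh)"
    using XX GX GG M_op_selfadjoint[OF A_sym N_sym, of X ?G]
    by (simp add: linear_diff[OF linear_M_op] inner_diff)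
  finally show ?thesis by (simp add: M_norm_def)
qed

text \<open>\<open>Xh\<close> is the Galerkin approximation of \<open>Y\<close>, so the difference of the two energies is the
  energy of \<open>Y ** transpose W - W ** Xh ** transpose W\<close>.\<close>

lemma galerkin_energy_le:
  assumes Y: "sylv_op A N Ah Nh Y = B ** transpose Bh"
  shows "Bh \<bullet> (Xh ** Bh) \<le> B \<bullet> (Y ** Bh)"
proof -
  let ?G = "W ** Xh ** transpose W" and ?D = "Y ** transpose W"
  have b: "Xh \<bullet> (Bh ** transpose Bh) = Bh \<bullet> (Xh ** Bh)"
    using inner_matrix_mult_right[of Xh Bh Bh] by (simp add: inner_commute)
  have a: "Y \<bullet> (B ** transpose Bh) = B \<bullet> (Y ** Bh)"
    using inner_matrix_mult_right[of Y Bh B] by (simp add: inner_commute)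
  have DD: "?D \<bullet> M_op A N ?D = B \<bullet> (Y ** Bh)"
    by (simp add: inner_matrix_mult_right M_op_lift_right Y a)
  have GD: "?G \<bullet> M_op A N ?D = Bh \<bullet> (Xh ** Bh)"
  proof -
    have "transpose W ** M_op A N ?D ** W = transpose W ** (M_op A N ?D ** W)"
      by (simp only: matrix_mul_assoc)
    also have "\<dots> = Bh ** transpose Bh" by (simp only: M_op_lift_right Y matrix_mul_assoc)
    finally show ?thesis by (simp only: inner_lift b)
  qed
  have GG: "?G \<bullet> M_op A N ?G = Bh \<bullet> (Xh ** Bh)"
    by (simp only: inner_lift M_op_lift_both M_op_Xh b)
  have "0 \<le> (?D - ?G) \<bullet> M_op A N (?D - ?G)" by (rule M_op_nonneg[OF dom])
  also have "\<dots> = B \<bullet> (Y ** Bh) - Bh \<bullet> (Xh ** Bh)"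
    using DD GD GG M_op_selfadjoint[OF A_sym N_sym, of ?D ?G]
    by (simp add: linear_diff[OF linear_M_op] inner_diff)
  finally show ?thesis by simp
qed

text \<open>The error Gramian has the blocks \<open>X\<close>, \<open>Y\<close>,
  \<open>transpose Y\<close> and \<open>Xh\<close>, none of which depends on the output matrix.
  Hence \<open>t\<close> enters only through the output, quadratically, and \<open>a\<close> is the
  mixed energy \<open>B \<bullet> (Y ** Bh)\<close>.\<close>

lemma h2_norm_error_system:
  assumes X: "M_op A N X = B ** transpose B"
  obtains a where "Bh \<bullet> (Xh ** Bh) \<le> a"
    "\<And>t. h2_defined (error_system (A, N, B, transpose B) (galerkin_output_scaled A N B W t))"
    "\<And>t. h2_norm (error_system (A, N, B, transpose B) (galerkin_output_scaled A N B W t))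
      = sqrt (B \<bullet> (X ** B) - 2 * t * a + t\<^sup>2 * (Bh \<bullet> (Xh ** Bh)))"
proof -
  let ?E = "inl_rows :: real^'n^('n + 'k)" and ?F = "inr_rows :: real^'k^('n + 'k)"
  define Ae where "Ae = block_diag A Ah"
  define Ne where "Ne = (\<chi> i. block_diag (N $ i) (Nh $ i))"
  define Be where "Be = stack_rows B Bh"
  \<comment> \<open>The error system is a compression of the full system with two blocks: the first
    component unchanged, the second projected by \<open>W\<close>.\<close>
  interpret compression "\<lambda>a. if a then transpose ?E else W ** transpose ?F"
  proof
    have "?F ** transpose W ** (W ** transpose ?F) = ?F ** (transpose W ** W) ** transpose ?F"
      by (simp only: matrix_mul_assoc)
    then show "(\<Sum>a\<in>UNIV. transpose (if a then transpose ?E else W ** transpose ?F)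
        ** (if a then transpose ?E else W ** transpose ?F)) = mat 1"
      using rows_complete[where 'n = 'n and 'k = 'k]
      by (simp add: UNIV_bool matrix_transpose_mul orth add.commute)
  qed
  have compress: "block_diag M (proj_mat W M) = compress M" for M
    by (simp add: compress_def block_diag_eq proj_mat_def UNIV_bool matrix_transpose_mul
        matrix_mul_assoc add.commute)
  have dom_e: "coupling_dominated Ae Ne"
    unfolding Ae_def compress
    by (rule coupling_dominated_compress[OF dom]) (simp add: Ne_def proj_coupling_def compress)
  have Ne_sym: "transpose (Ne $ i) = Ne $ i" for i
    by (simp add: Ne_def proj_coupling_def compress transpose_compress N_sym)
  obtain P where P: "M_op Ae Ne P = Be ** transpose Be"
    using M_op_unique_solution[OF dom_e] by blast
  \<comment> \<open>The transpose solves the same uniquely solvable equation, so \<open>P\<close> is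
    symmetric and its two mixed blocks are transposes of each other.\<close>
  have "M_op Ae Ne (transpose P) = M_op Ae Ne P"
    by (simp add: M_op_transpose P matrix_transpose_mul)
  then have P_sym: "transpose P = P"
    using M_op_unique_solution[OF dom_e] by blast
  have left: "transpose ?E ** block_diag M M' = M ** transpose ?E"
    "transpose ?F ** block_diag M M' = M' ** transpose ?F" for M M'
    by (simp_all add: block_diag_eq matrix_mult.add_right matrix_mul_assoc matrix_mult.zero_left)
  have N_left: "transpose ?E ** Ne $ i = N $ i ** transpose ?E"
    "transpose ?F ** Ne $ i = Nh $ i ** transpose ?F" for i
    by (simp_all add: Ne_def left)
  have A_left: "transpose ?E ** Ae = A ** transpose ?E" "transpose ?F ** Ae = Ah ** transpose ?F"
    by (simp_all add: Ae_def left)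
  have Be_left: "transpose ?E ** Be = B" "transpose ?F ** Be = Bh"
    by (simp_all add: Be_def stack_rows_eq matrix_mult.add_right matrix_mul_assoc matrix_mult.zero_left)
  have Be_right: "transpose Be ** ?E = transpose B" "transpose Be ** ?F = transpose Bh"
    using Be_left[THEN arg_cong, of transpose] by (simp_all add: matrix_transpose_mul)
  define Y where "Y = transpose ?E ** P ** ?F"
  have "M_op A N (transpose ?E ** P ** ?E) = transpose ?E ** Be ** (transpose Be ** ?E)"
    using sylv_op_intertwine[OF A_left(1) N_left(1) A_left(1) N_left(1), of P]
    by (simp add: P matrix_mul_assoc)
  then have "M_op A N (transpose ?E ** P ** ?E) = M_op A N X"
    by (simp only: Be_left Be_right X)
  then have EE: "transpose ?E ** P ** ?E = X"
    using M_op_unique_solution[OF dom] by blast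
  have "M_op Ah Nh (transpose ?F ** P ** ?F) = transpose ?F ** Be ** (transpose Be ** ?F)"
    using sylv_op_intertwine[OF A_left(2) N_left(2) A_left(2) N_left(2), of P]
    by (simp add: P matrix_mul_assoc)
  then have FF: "transpose ?F ** P ** ?F = Xh"
    by (simp only: Be_left Be_right flip: projected_solution_iff)
  have "sylv_op A N Ah Nh Y = transpose ?E ** Be ** (transpose Be ** ?F)"
    using sylv_op_intertwine[OF A_left(1) N_left(1) A_left(2) N_left(2), of P]
    by (simp add: P Y_def matrix_mul_assoc)
  then have Y: "sylv_op A N Ah Nh Y = B ** transpose Bh"
    by (simp only: Be_left Be_right)
  have FE: "transpose ?F ** P ** ?E = transpose Y"
    by (simp add: Y_def matrix_transpose_mul P_sym matrix_mul_assoc)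
  show thesis
  proof (rule that[OF galerkin_energy_le[OF Y]])
    fix t
    define Ce where "Ce = join_columns (transpose B) (- (t *\<^sub>R transpose Bh))"
    have sys: "error_system (A, N, B, transpose B) (galerkin_output_scaled A N B W t) = (Ae, Ne, Be, Ce)"
      by (simp add: galerkin_output_scaled_def Ae_def Ne_def Be_def Ce_def)
    note h2 = h2_norm_eq_trace_gramian[OF Ne_sym dom_e P, of Ce, folded sys]
    show "h2_defined (error_system (A, N, B, transpose B) (galerkin_output_scaled A N B W t))"
      by (rule h2(1))
    have Ce: "transpose Ce = ?E ** B - t *\<^sub>R (?F ** Bh)"
      by (simp add: Ce_def join_columns_eq transpose_diff transpose_scalar
          linear_neg[OF linear_transpose] matrix_transpose_mul matrix_mult.minus_left
          matrix_mult.scaleR_left matrix_mult.scaleR_right matrix_mul_assoc)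
    have inner: "(?E ** B) \<bullet> (P ** (?E ** B)) = B \<bullet> (X ** B)"
      "(?E ** B) \<bullet> (P ** (?F ** Bh)) = B \<bullet> (Y ** Bh)"
      "(?F ** Bh) \<bullet> (P ** (?E ** B)) = Bh \<bullet> (transpose Y ** B)"
      "(?F ** Bh) \<bullet> (P ** (?F ** Bh)) = Bh \<bullet> (Xh ** Bh)"
      by (simp_all only: inner_sandwich EE FF FE Y_def[symmetric])
    have "Bh \<bullet> (transpose Y ** B) = B \<bullet> (Y ** Bh)"
      using inner_matrix_mult_left[of Y Bh B] by (simp add: inner_commute)
    have "trace (Ce ** P ** transpose Ce) = transpose Ce \<bullet> (P ** transpose Ce)"
      by (simp add: inner_matrix_eq_trace matrix_mul_assoc)
    also have "\<dots> = B \<bullet> (X ** B) - 2 * t * (B \<bullet> (Y ** Bh)) + t\<^sup>2 * (Bh \<bullet> (Xh ** Bh))"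
      unfolding Ce
      by (simp add: matrix_mult.diff_right matrix_mult.scaleR_right inner_diff inner
          \<open>Bh \<bullet> (transpose Y ** B) = _\<close> power2_eq_square algebra_simps)
    finally show "h2_norm (error_system (A, N, B, transpose B) (galerkin_output_scaled A N B W t))
      = sqrt (B \<bullet> (X ** B) - 2 * t * (B \<bullet> (Y ** Bh)) + t\<^sup>2 * (Bh \<bullet> (Xh ** Bh)))"
      by (simp add: h2(2))
  qed
qed

end

section \<open>Pulling back local minimality and the conclusion\<close>

lemma local_minimizer_compose:
  assumes min: "local_minimizer f S (g w)" and "w \<in> D"
    and cont: "(g \<longlongrightarrow> g w) (at w within D)" and maps: "\<And>v. v \<in> D \<Longrightarrow> g v \<in> S"
  shows "local_minimizer (\<lambda>v. f (g v)) D w"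
proof -
  obtain T where T: "open T" "g w \<in> T" "\<And>y. y \<in> T \<Longrightarrow> y \<noteq> g w \<Longrightarrow> y \<in> S \<Longrightarrow> f (g w) \<le> f y"
    using min unfolding local_minimizer_def eventually_at_topological by blast
  have "\<forall>\<^sub>F v in at w within D. v \<in> D" by (simp add: eventually_at_filter)
  then have "\<forall>\<^sub>F v in at w within D. f (g w) \<le> f (g v)"
    using topological_tendstoD[OF cont T(1,2)]
  proof eventually_elim
    case (elim v)
    \<comment> \<open>Minimality is stated on a punctured neighbourhood, and \<open>g\<close> may
      return to \<open>g w\<close> for \<open>v \<noteq> w\<close>; there the values agree.\<close>
    then show ?case using T(3)[of "g v"] maps by (cases "g v = g w") auto
  qed
  with \<open>w \<in> D\<close> show ?thesis by (simp add: local_minimizer_def)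
qed

text \<open>Since \<open>sqrt\<close> is strictly increasing on the reals, the radicand has a local
  minimum at 1, where its derivative is \<open>- 2 * a + 2 * b\<close>.\<close>

lemma local_minimizer_quadratic:
  fixes a b c :: real
  assumes "local_minimizer (\<lambda>t. sqrt (c - 2 * t * a + t\<^sup>2 * b)) UNIV 1"
  shows "a = b"
proof -
  let ?q = "\<lambda>t. c - 2 * t * a + t\<^sup>2 * b"
  obtain d where d: "0 < d" "\<And>t. t \<noteq> 1 \<Longrightarrow> dist t 1 < d \<Longrightarrow> ?q 1 \<le> ?q t"
    using assms by (auto simp: local_minimizer_def eventually_at)
  have "(?q has_real_derivative - 2 * a + 2 * b) (at 1)"
    by (auto intro!: derivative_eq_intros)
  moreover have "\<forall>t. \<bar>1 - t\<bar> < d \<longrightarrow> ?q 1 \<le> ?q t"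
    using d(2) by (metis abs_minus_commute dist_real_def order_refl)
  ultimately have "- 2 * a + 2 * b = 0"
    using DERIV_local_min[OF _ d(1)] by blast
  then show ?thesis by simp
qed

lemma tendsto_galerkin_output_scaled:
  fixes A :: "real^'n^'n" and N :: "real^'n^'n^'m" and B :: "real^'r^'n"
  assumes W: "(W \<longlongrightarrow> W') F" and t: "(t \<longlongrightarrow> t') F"
  shows "((\<lambda>x. galerkin_output_scaled A N B (W x) (t x)) \<longlongrightarrow> galerkin_output_scaled A N B W' t') F"
  unfolding galerkin_output_scaled_def proj_coupling_def proj_mat_def
  by (intro tendsto_Pair tendsto_vec_lambda matrix_mult.tendsto tendsto_scaleR tendsto_const
      bounded_linear.tendsto[OF bounded_linear_transpose] W t)

theorem theorem3p2:
  fixes A X :: "real^'n^'n"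
    and N :: "real^'n^'n^'m"
    and B :: "real^'r^'n"
    and C :: "real^'n^'r"
    and V :: "real^'k^'n"
    and Ahat Xhat :: "real^'k^'k"
    and Nhat :: "real^'k^'k^'m"
    and Bhat :: "real^'r^'k"
    and Chat :: "real^'k^'r"
  assumes A_sym: "A = transpose A"
    and A_neg: "\<And>x. x \<noteq> 0 \<Longrightarrow> x \<bullet> (A *v x) < 0"
    and N_sym: "\<And>i. N $ i = transpose (N $ i)"
    and C_eq: "C = transpose B"
    and rho: "spectral_radius (inv (lyap A) \<circ> coupling N) < 1"
    and X_sol: "A ** X + X ** A + (\<Sum>i\<in>UNIV. N $ i ** X ** N $ i) + B ** transpose B = 0"
    and k_less_n: "CARD('k) < CARD('n)"
    and V_orth: "transpose V ** V = mat 1"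
    and Ahat_eq: "Ahat = transpose V ** A ** V"
    and Nhat_eq: "\<And>i. Nhat $ i = transpose V ** N $ i ** V"
    and Bhat_eq: "Bhat = transpose V ** B"
    and Chat_eq: "Bhat = transpose Chat"
    and Xhat_sol: "Ahat ** Xhat + Xhat ** Ahat
      + (\<Sum>i\<in>UNIV. Nhat $ i ** Xhat ** transpose (Nhat $ i)) + Bhat ** transpose Bhat = 0"
    and h2_opt: "locally_h2_optimal (A, N, B, C) (Ahat, Nhat, Bhat, Chat)"
  shows "projected_solution A N B V = Xhat \<and>
    local_minimizer (\<lambda>W. M_norm A N (X - W ** projected_solution A N B W ** transpose W))
      {W. transpose W ** W = mat 1} V"
proof
  let ?O = "{W :: real^'k^'n. transpose W ** W = mat 1}"
  have sym: "transpose A = A" "transpose (N $ i) = N $ i" for i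
    using A_sym N_sym[of i] by simp_all
  have "coupling_dominated A N"
    by (rule coupling_dominated_if_spectral_radius[OF sym A_neg rho])
  then have galerkin: "galerkin A N W" if "W \<in> ?O" for W
    using sym that by unfold_locales auto
  have V: "V \<in> ?O" using V_orth by simp
  have X: "M_op A N X = B ** transpose B"
    using X_sol by (simp add: M_op_eq_iff lyap_def coupling_def sym)
  have hats: "Ahat = proj_mat V A" "Nhat = proj_coupling V N"
    by (simp_all add: Ahat_eq Nhat_eq proj_mat_def proj_coupling_def vec_eq_iff)
  have "transpose Ahat = Ahat"
    unfolding hats by (rule galerkin.Ah_sym[OF galerkin[OF V]])
  then have "M_op Ahat Nhat Xhat = Bhat ** transpose Bhat"
    using Xhat_sol by (simp add: M_op_eq_iff lyap_def coupling_def)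
  then show "projected_solution A N B V = Xhat"
    unfolding galerkin.projected_solution_iff[OF galerkin[OF V]] hats Bhat_eq .

  define b where "b W = (transpose W ** B) \<bullet> (projected_solution A N B W ** (transpose W ** B))"
    for W :: "real^'k^'n"
  define x where "x = B \<bullet> (X ** B)"
  define err where "err W t = error_system (A, N, B, C) (galerkin_output_scaled A N B W t)"
    for W :: "real^'k^'n" and t
  have "\<exists>a. b W \<le> a \<and> (\<forall>t. h2_defined (err W t)) \<and>
      (\<forall>t. h2_norm (err W t) = sqrt (x - 2 * t * a + t\<^sup>2 * b W))" if "W \<in> ?O" for W
    using galerkin.h2_norm_error_system[OF galerkin[OF that] X]
    unfolding b_def x_def err_def C_eq by metis
  \<comment> \<open>The mixed energy depends on \<open>W\<close> but not on \<open>t\<close>, so it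
    can be chosen as a function of \<open>W\<close> alone.\<close>
  then have "\<exists>a. \<forall>W\<in>?O. b W \<le> a W \<and> (\<forall>t. h2_defined (err W t)) \<and>
      (\<forall>t. h2_norm (err W t) = sqrt (x - 2 * t * a W + t\<^sup>2 * b W))"
    by (intro bchoice) blast
  then obtain a where "\<forall>W\<in>?O. b W \<le> a W \<and> (\<forall>t. h2_defined (err W t)) \<and>
      (\<forall>t. h2_norm (err W t) = sqrt (x - 2 * t * a W + t\<^sup>2 * b W))" ..
  then have a: "b W \<le> a W" "h2_defined (err W t)"
    "h2_norm (err W t) = sqrt (x - 2 * t * a W + t\<^sup>2 * b W)" if "W \<in> ?O" for W t
    using that by blast+
  have sys: "(Ahat, Nhat, Bhat, Chat) = galerkin_output_scaled A N B V 1"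
    using Chat_eq by (simp add: galerkin_output_scaled_def hats Bhat_eq[symmetric])
  have min: "local_minimizer (\<lambda>S. h2_norm (error_system (A, N, B, C) S))
      {S. h2_defined (error_system (A, N, B, C) S)} (galerkin_output_scaled A N B V 1)"
    using h2_opt unfolding locally_h2_optimal_def sys .

  \<comment> \<open>First family of competitors: \<open>V\<close> stays fixed and the output matrix
    is scaled. Stationarity at \<open>t = 1\<close> equates the mixed and the projected
    energy.\<close>
  have "local_minimizer (\<lambda>t. h2_norm (err V t)) UNIV 1"
    unfolding err_def
    by (rule local_minimizer_compose[where g = "galerkin_output_scaled A N B V", OF min])
      (use a(2)[OF V] in \<open>auto simp: err_def intro: tendsto_galerkin_output_scaled tendsto_ident_at tendsto_const\<close>)
  then have eq: "a V = b V"
    unfolding a(3)[OF V] by (rule local_minimizer_quadratic)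

  \<comment> \<open>Second family of competitors: the Galerkin systems of all orthonormal
    \<open>W\<close>, with \<open>t = 1\<close>.\<close>
  have "local_minimizer (\<lambda>W. h2_norm (err W 1)) ?O V"
    unfolding err_def
    by (rule local_minimizer_compose[where g = "\<lambda>W. galerkin_output_scaled A N B W 1", OF min V])
      (use a(2) in \<open>auto simp: err_def intro: tendsto_galerkin_output_scaled tendsto_ident_at tendsto_const\<close>)
  then have "\<forall>\<^sub>F W in at V within ?O. h2_norm (err V 1) \<le> h2_norm (err W 1)"
    by (simp add: local_minimizer_def)
  moreover have "\<forall>\<^sub>F W in at V within ?O. W \<in> ?O" by (simp add: eventually_at_filter)
  \<comment> \<open>At \<open>V\<close> the H2 radicand is \<open>x - b V\<close> because
    \<open>a V = b V\<close>; at \<open>W\<close> it is \<open>x - 2 * a W + b W\<close>, which is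
    at most \<open>x - b W\<close> because \<open>b W \<le> a W\<close>.\<close>
  ultimately have "\<forall>\<^sub>F W in at V within ?O. sqrt (x - b V) \<le> sqrt (x - b W)"
  proof eventually_elim
    case (elim W)
    then show ?case using a(1)[of W] eq by (simp add: a(3)[OF V] a(3)[of W])
  qed
  moreover have M: "M_norm A N (X - W ** projected_solution A N B W ** transpose W) = sqrt (x - b W)"
    if "W \<in> ?O" for W
    unfolding x_def b_def by (rule galerkin.M_norm_galerkin_error[OF galerkin[OF that] X])
  ultimately have "\<forall>\<^sub>F W in at V within ?O. M_norm A N (X - V ** projected_solution A N B V ** transpose V)
      \<le> M_norm A N (X - W ** projected_solution A N B W ** transpose W)"
    unfolding eventually_at_filter using V by (simp add: M)
  then show "local_minimizer (\<lambda>W. M_norm A N (X - W ** projected_solution A N B W ** transpose W)) ?O V"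
    using V by (simp add: local_minimizer_def)
qed

end
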